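(* Let $q_1,q_2$ be integers with $1\le q_1\le q_2$, $A=\begin{pmatrix}3q_1&0\\0&3q_2\end{pmatrix}$, $\mathcal{D}=\left\{\begin{pmatrix}0\\0\end{pmatrix},\begin{pmatrix}1\\0\end{pmatrix},\begin{pmatrix}0\\1\end{pmatrix}\right\}$, and $\mu_{A,\mathcal{D}}$ the associated Sierpiński-type measure. For any orthogonal set $\Lambda$ of $\mu_{A,\mathcal{D}}$ we have $\dim_{Be}(\Lambda)\le\frac{\log 3}{\log 3q_2}$. Moreover, if $\Lambda$ is a spectrum of $\mu_{A,\mathcal{D}}$ and there exists an integer $p\ge1$ such that $$\sup_{\lambda\in\Lambda}\inf_{\gamma\in\Lambda}\|A^{-p}\lambda-\gamma\|<+\infty,$$ then $\dim_{Be}(\Lambda)=\frac{\log 3}{\log 3q_2}$.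
   Context: $\mu_{A,\mathcal{D}}$ is the unique Borel probability measure on $\mathbb{R}^2$ with $\mu_{A,\mathcal{D}}(E)=\frac13\sum_{d\in\mathcal{D}}\mu_{A,\mathcal{D}}(AE-d)$ for Borel $E$. A countable $\Lambda\subseteq\mathbb{R}^2$ is an orthogonal set of $\mu$ if $\{e^{-2\pi i\langle\lambda,x\rangle}:\lambda\in\Lambda\}$ is an orthogonal family in $L^2(\mu)$, and a spectrum if it is an orthonormal basis of $L^2(\mu)$. For a countable $\Lambda\subseteq\mathbb{R}^d$ and $r>0$, $D_r^+(\Lambda)=\limsup_{h\to\infty}\sup_{x\in\mathbb{R}^d}\#(\Lambda\cap B(x,h))/h^r$, where $B(x,h)$ is the open ball of radius $h$ about $x$; the (upper) Beurling dimension is $\dim_{Be}(\Lambda)=\inf\{r:D_r^+(\Lambda)=0\}=\sup\{r:D_r^+(\Lambda)=\infty\}$. *)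

theory Defs
  imports "HOL-Analysis.Analysis" "HOL-Probability.Probability"
begin

definition Amat :: "int \<Rightarrow> int \<Rightarrow> real^2^2" where
  "Amat q1 q2 = (\<chi> i j. if i = j then (if i = 1 then 3 * real_of_int q1 else 3 * real_of_int q2) else 0)"

definition Sdigits :: "(real^2) set" where
  "Sdigits = {vector [0, 0], vector [1, 0], vector [0, 1]}"

text \<open>mu is the self-affine measure mu_{A,D}: a Borel probability measure on R^2 with
  mu(E) = 1/3 * sum_{d in D} mu(A E - d) for all Borel E (such a measure is unique).\<close>
definition self_affine_measure :: "real^2^2 \<Rightarrow> (real^2) set \<Rightarrow> (real^2) measure \<Rightarrow> bool" where
  "self_affine_measure A D \<mu> \<longleftrightarrow>
     prob_space \<mu> \<and> sets \<mu> = sets borel \<and>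
     (\<forall>E \<in> sets borel. measure \<mu> E = (1/3) * (\<Sum>d\<in>D. measure \<mu> ((\<lambda>x. A *v x - d) ` E)))"

definition expo :: "real^2 \<Rightarrow> real^2 \<Rightarrow> complex" where
  "expo l x = exp (- (2 * pi * \<i>) * complex_of_real (l \<bullet> x))"

definition L2inner :: "'a measure \<Rightarrow> ('a \<Rightarrow> complex) \<Rightarrow> ('a \<Rightarrow> complex) \<Rightarrow> complex" where
  "L2inner \<mu> f g = integral\<^sup>L \<mu> (\<lambda>x. f x * cnj (g x))"

definition orthogonal_set :: "(real^2) measure \<Rightarrow> (real^2) set \<Rightarrow> bool" where
  "orthogonal_set \<mu> \<Lambda> \<longleftrightarrow> countable \<Lambda> \<and>
     (\<forall>l\<in>\<Lambda>. \<forall>\<gamma>\<in>\<Lambda>. l \<noteq> \<gamma> \<longrightarrow> L2inner \<mu> (expo l) (expo \<gamma>) = 0)"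

definition square_integrable :: "'a measure \<Rightarrow> ('a \<Rightarrow> complex) \<Rightarrow> bool" where
  "square_integrable \<mu> f \<longleftrightarrow> f \<in> borel_measurable \<mu> \<and> integrable \<mu> (\<lambda>x. (cmod (f x))\<^sup>2)"

text \<open>Spectrum: the exponentials form an orthonormal basis of L^2(mu), i.e. they are
  orthogonal (normalisation is automatic, |e_lambda| = 1 and mu is a probability measure) and
  complete: only the zero element of L^2(mu) is orthogonal to all of them.\<close>
definition spectrum_of :: "(real^2) measure \<Rightarrow> (real^2) set \<Rightarrow> bool" where
  "spectrum_of \<mu> \<Lambda> \<longleftrightarrow> orthogonal_set \<mu> \<Lambda> \<and>
     (\<forall>f. square_integrable \<mu> f \<longrightarrow> (\<forall>l\<in>\<Lambda>. L2inner \<mu> f (expo l) = 0) \<longrightarrow>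
          (AE x in \<mu>. f x = 0))"

definition ecard :: "'a set \<Rightarrow> ereal" where
  "ecard S = (if finite S then ereal (real (card S)) else \<infinity>)"

definition upper_beurling_density :: "real \<Rightarrow> ('a::metric_space) set \<Rightarrow> ereal" where
  "upper_beurling_density r \<Lambda> =
     Limsup at_top (\<lambda>h::real. SUP x. ecard (\<Lambda> \<inter> ball x h) / ereal (h powr r))"

definition beurling_dim :: "('a::metric_space) set \<Rightarrow> ereal" where
  "beurling_dim \<Lambda> = Inf (ereal ` {r. r > 0 \<and> upper_beurling_density r \<Lambda> = 0})"

definition Ainv_pow :: "real^2^2 \<Rightarrow> nat \<Rightarrow> real^2 \<Rightarrow> real^2" where
  "Ainv_pow A p v = ((\<lambda>w. matrix_inv A *v w) ^^ p) v"

end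

theory Submission
  imports Defs
begin

text \<open>
  Write \<open>m\<close> for the mask of the digit set, so that \<open>ft \<xi> = m (A\<inverse> \<xi>) ft (A\<inverse> \<xi>)\<close>. The mask vanishes
  only at points both of whose coordinates are thirds of integers prime to 3, hence differences in an
  orthogonal set have coordinates \<open>(3 q\<^sub>i) ^ j k / 3\<close> with a common \<open>j\<close>. In a ball of radius at most
  \<open>(3 q\<^sub>2) ^ n / 2\<close> the second coordinate forces \<open>j \<le> n\<close>, and then successive residues mod 3 of the
  first coordinate separate at most \<open>3 ^ n\<close> points.

  For a spectrum, summing the Parseval identity over \<open>3 ^ n\<close> integer frequencies on which the squared
  moduli of the \<open>n\<close>-fold mask product always add up to 1 bounds \<open>3 ^ n\<close> by
  a constant times \<open>\<Sum>\<^sub>l |ft (A\<^sup>-\<^sup>n l + O(1))|\<^sup>2\<close>. If every \<open>A\<^sup>-\<^sup>n l\<close> is close to a point of the spectrum, a perturbed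
  Bessel inequality bounds this sum by a constant times the largest number of \<open>l\<close> sharing the same
  nearby point, and all of these lie in a ball of radius \<open>O((3 q\<^sub>2) ^ n)\<close>.
\<close>

section \<open>Riesz--Fischer and Parseval for orthonormal families\<close>

abbreviation sqnorm :: "'a measure \<Rightarrow> ('a \<Rightarrow> complex) \<Rightarrow> real" where
  "sqnorm M f \<equiv> integral\<^sup>L M (\<lambda>x. (cmod (f x))\<^sup>2)"

lemma borel_measurable_cnj [measurable]: "cnj \<in> borel_measurable borel"
  by (intro borel_measurable_continuous_onI continuous_intros)

lemma square_integrable_times:
  assumes "square_integrable M f" "square_integrable M g"
  shows "integrable M (\<lambda>x. f x * cnj (g x))"
proof (rule Bochner_Integration.integrable_bound)
  show "integrable M (\<lambda>x. (cmod (f x))\<^sup>2 + (cmod (g x))\<^sup>2)"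
    using assms by (auto simp: square_integrable_def)
  show "(\<lambda>x. f x * cnj (g x)) \<in> borel_measurable M"
    using assms by (auto simp: square_integrable_def intro: measurable_compose[OF _ borel_measurable_cnj])
  show "AE x in M. norm (f x * cnj (g x)) \<le> norm ((cmod (f x))\<^sup>2 + (cmod (g x))\<^sup>2)"
  proof (rule AE_I2)
    fix x
    have "2 * (cmod (f x) * cmod (g x)) \<le> (cmod (f x))\<^sup>2 + (cmod (g x))\<^sup>2"
      using sum_squares_bound[of "cmod (f x)" "cmod (g x)"] by simp
    moreover have "0 \<le> cmod (f x) * cmod (g x)" by simp
    ultimately have "cmod (f x) * cmod (g x) \<le> (cmod (f x))\<^sup>2 + (cmod (g x))\<^sup>2" by linarith
    then show "norm (f x * cnj (g x)) \<le> norm ((cmod (f x))\<^sup>2 + (cmod (g x))\<^sup>2)"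
      by (simp add: norm_mult)
  qed
qed

lemma square_integrable_add:
  assumes "square_integrable M f" "square_integrable M g"
  shows "square_integrable M (\<lambda>x. f x + g x)"
  unfolding square_integrable_def
proof
  show m: "(\<lambda>x. f x + g x) \<in> borel_measurable M"
    using assms by (auto simp: square_integrable_def)
  show "integrable M (\<lambda>x. (cmod (f x + g x))\<^sup>2)"
  proof (rule Bochner_Integration.integrable_bound)
    show "integrable M (\<lambda>x. 2 * (cmod (f x))\<^sup>2 + 2 * (cmod (g x))\<^sup>2)"
      using assms by (auto simp: square_integrable_def)
    show "(\<lambda>x. (cmod (f x + g x))\<^sup>2) \<in> borel_measurable M"
      using m by simp
    show "AE x in M. norm ((cmod (f x + g x))\<^sup>2) \<le> norm (2 * (cmod (f x))\<^sup>2 + 2 * (cmod (g x))\<^sup>2)"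
    proof (rule AE_I2)
      fix x
      have "(cmod (f x + g x))\<^sup>2 \<le> (cmod (f x) + cmod (g x))\<^sup>2"
        by (intro power_mono norm_triangle_ineq) auto
      also have "\<dots> \<le> 2 * (cmod (f x))\<^sup>2 + 2 * (cmod (g x))\<^sup>2"
        using sum_squares_bound[of "cmod (f x)" "cmod (g x)"] by (simp add: power2_sum)
      finally show "norm ((cmod (f x + g x))\<^sup>2) \<le> norm (2 * (cmod (f x))\<^sup>2 + 2 * (cmod (g x))\<^sup>2)"
        by simp
    qed
  qed
qed

lemma square_integrable_cmult:
  assumes "square_integrable M f"
  shows "square_integrable M (\<lambda>x. c * f x)"
  using assms by (auto simp: square_integrable_def norm_mult power_mult_distrib)

lemma square_integrable_diff:
  assumes "square_integrable M f" "square_integrable M g"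
  shows "square_integrable M (\<lambda>x. f x - g x)"
  using square_integrable_add[OF assms(1) square_integrable_cmult[OF assms(2), of "-1"]] by simp

lemma square_integrable_sum:
  assumes "\<And>i. i \<in> F \<Longrightarrow> square_integrable M (f i)"
  shows "square_integrable M (\<lambda>x. \<Sum>i\<in>F. f i x)"
  using assms
proof (induction F rule: infinite_finite_induct)
  case (insert i F)
  then show ?case by (simp add: square_integrable_add)
qed (auto simp: square_integrable_def)

lemma L2inner_diff_left:
  assumes "square_integrable M f" "square_integrable M g" "square_integrable M h"
  shows "L2inner M (\<lambda>x. f x - g x) h = L2inner M f h - L2inner M g h"
  using square_integrable_times[OF assms(1,3)] square_integrable_times[OF assms(2,3)]
  by (simp add: L2inner_def algebra_simps)

lemma L2inner_sum_left:
  assumes "\<And>i. i \<in> F \<Longrightarrow> square_integrable M (f i)" "square_integrable M h"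
  shows "L2inner M (\<lambda>x. \<Sum>i\<in>F. c i * f i x) h = (\<Sum>i\<in>F. c i * L2inner M (f i) h)"
proof -
  have "L2inner M (\<lambda>x. \<Sum>i\<in>F. c i * f i x) h
      = integral\<^sup>L M (\<lambda>x. \<Sum>i\<in>F. c i * (f i x * cnj (h x)))"
    by (simp add: L2inner_def sum_distrib_right mult.assoc)
  also have "\<dots> = (\<Sum>i\<in>F. integral\<^sup>L M (\<lambda>x. c i * (f i x * cnj (h x))))"
    using square_integrable_times[OF assms(1) assms(2)]
    by (intro Bochner_Integration.integral_sum) auto
  also have "\<dots> = (\<Sum>i\<in>F. c i * L2inner M (f i) h)"
    by (simp add: L2inner_def)
  finally show ?thesis .
qed

lemma L2inner_commute: "L2inner M g f = cnj (L2inner M f g)"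
  by (simp add: L2inner_def mult.commute flip: Bochner_Integration.integral_cnj)

lemma L2inner_self: "L2inner M f f = of_real (sqnorm M f)"
  by (simp add: L2inner_def complex_norm_square[symmetric] flip: integral_complex_of_real)

lemma sqnorm_diff:
  assumes "square_integrable M f" "square_integrable M g"
  shows "sqnorm M (\<lambda>x. f x - g x) = sqnorm M f + sqnorm M g - 2 * Re (L2inner M f g)"
proof -
  have d: "square_integrable M (\<lambda>x. f x - g x)" using assms by (rule square_integrable_diff)
  have "complex_of_real (sqnorm M (\<lambda>x. f x - g x))
     = L2inner M f (\<lambda>x. f x - g x) - L2inner M g (\<lambda>x. f x - g x)"
    unfolding L2inner_self[symmetric] by (rule L2inner_diff_left) (use assms d in auto)
  also have "\<dots> = cnj (L2inner M (\<lambda>x. f x - g x) f) - cnj (L2inner M (\<lambda>x. f x - g x) g)"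
    by (simp add: L2inner_commute[of M "\<lambda>x. f x - g x"])
  also have "\<dots> = cnj (L2inner M f f - L2inner M g f) - cnj (L2inner M f g - L2inner M g g)"
    using assms by (simp add: L2inner_diff_left)
  also have "\<dots> = of_real (sqnorm M f) + of_real (sqnorm M g) - (L2inner M f g + cnj (L2inner M f g))"
    by (simp add: L2inner_self L2inner_commute[of M g f])
  also have "\<dots> = of_real (sqnorm M f + sqnorm M g - 2 * Re (L2inner M f g))"
    by (simp add: complex_add_cnj)
  finally show ?thesis using of_real_eq_iff by blast
qed

section \<open>Finite orthonormal combinations and Bessel's inequality\<close>

locale orthonormal_family =
  fixes M :: "'a measure" and I :: "'i set" and e :: "'i \<Rightarrow> 'a \<Rightarrow> complex"
  assumes square_integrable_family: "i \<in> I \<Longrightarrow> square_integrable M (e i)"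
    and orthonormal: "\<lbrakk>i \<in> I; j \<in> I\<rbrakk> \<Longrightarrow> L2inner M (e i) (e j) = (if i = j then 1 else 0)"
begin

lemma inner_combination:
  assumes "finite F" "F \<subseteq> I" "j \<in> I"
  shows "L2inner M (\<lambda>x. \<Sum>i\<in>F. c i * e i x) (e j) = (if j \<in> F then c j else 0)"
proof -
  have "L2inner M (\<lambda>x. \<Sum>i\<in>F. c i * e i x) (e j) = (\<Sum>i\<in>F. c i * L2inner M (e i) (e j))"
    using assms by (intro L2inner_sum_left square_integrable_family) auto
  also have "\<dots> = (\<Sum>i\<in>F. if i = j then c i else 0)"
    using assms by (intro sum.cong) (auto simp: orthonormal subset_iff)
  finally show ?thesis using assms by simp
qed

lemma square_integrable_combination:
  assumes "F \<subseteq> I"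
  shows "square_integrable M (\<lambda>x. \<Sum>i\<in>F. c i * e i x)"
  using assms by (intro square_integrable_sum square_integrable_cmult square_integrable_family) auto

lemma inner_combination_right:
  assumes "finite F" "F \<subseteq> I" "square_integrable M f"
  shows "L2inner M f (\<lambda>x. \<Sum>i\<in>F. c i * e i x) = (\<Sum>i\<in>F. cnj (c i) * L2inner M f (e i))"
proof -
  have "L2inner M (\<lambda>x. \<Sum>i\<in>F. c i * e i x) f = (\<Sum>i\<in>F. c i * L2inner M (e i) f)"
    using assms by (intro L2inner_sum_left square_integrable_family) auto
  then show ?thesis
    by (subst L2inner_commute) (simp add: L2inner_commute[of M _ f])
qed

lemma sqnorm_combination:
  assumes "finite F" "F \<subseteq> I"
  shows "sqnorm M (\<lambda>x. \<Sum>i\<in>F. c i * e i x) = (\<Sum>i\<in>F. (cmod (c i))\<^sup>2)"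
proof -
  have "complex_of_real (sqnorm M (\<lambda>x. \<Sum>i\<in>F. c i * e i x))
     = (\<Sum>i\<in>F. cnj (c i) * L2inner M (\<lambda>x. \<Sum>i\<in>F. c i * e i x) (e i))"
    unfolding L2inner_self[symmetric]
    using assms by (intro inner_combination_right square_integrable_combination)
  also have "\<dots> = (\<Sum>i\<in>F. cnj (c i) * c i)"
    using assms by (intro sum.cong) (auto simp: inner_combination subset_iff)
  also have "\<dots> = of_real (\<Sum>i\<in>F. (cmod (c i))\<^sup>2)"
    by (simp only: of_real_sum complex_norm_square mult.commute)
  finally show ?thesis using of_real_eq_iff by blast
qed

text \<open>Pythagoras: the remainder is orthogonal to the span of the finite subfamily. Its
  nonnegativity gives \<open>bessel\<close>, and later it measures how far a partial sum is from
  \<open>f\<close>.\<close>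

lemma sqnorm_remainder:
  assumes "finite F" "F \<subseteq> I" "square_integrable M f"
  shows "sqnorm M (\<lambda>x. f x - (\<Sum>i\<in>F. L2inner M f (e i) * e i x))
       = sqnorm M f - (\<Sum>i\<in>F. (cmod (L2inner M f (e i)))\<^sup>2)"
proof -
  have "L2inner M f (\<lambda>x. \<Sum>i\<in>F. L2inner M f (e i) * e i x)
     = (\<Sum>i\<in>F. cnj (L2inner M f (e i)) * L2inner M f (e i))"
    using assms by (rule inner_combination_right)
  also have "\<dots> = of_real (\<Sum>i\<in>F. (cmod (L2inner M f (e i)))\<^sup>2)"
    by (simp only: of_real_sum complex_norm_square mult.commute)
  finally show ?thesis
    using assms by (simp add: sqnorm_diff square_integrable_combination sqnorm_combination)
qed

lemma bessel:
  assumes "finite F" "F \<subseteq> I" "square_integrable M f"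
  shows "(\<Sum>i\<in>F. (cmod (L2inner M f (e i)))\<^sup>2) \<le> sqnorm M f"
proof -
  have "0 \<le> sqnorm M (\<lambda>x. f x - (\<Sum>i\<in>F. L2inner M f (e i) * e i x))" by simp
  then show ?thesis using sqnorm_remainder[OF assms] by linarith
qed

end

text \<open>The variance of \<open>cmod (f x)\<close> is nonnegative; this is Cauchy-Schwarz against
  the constant 1 on a probability space.\<close>

lemma (in prob_space) integral_cmod_le_sqrt_sqnorm:
  assumes "square_integrable M f"
  shows "integrable M (\<lambda>x. cmod (f x))" "integral\<^sup>L M (\<lambda>x. cmod (f x)) \<le> sqrt (sqnorm M f)"
proof -
  have "square_integrable M (\<lambda>_. 1)" by (auto simp: square_integrable_def)
  from square_integrable_times[OF assms this] show i: "integrable M (\<lambda>x. cmod (f x))"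
    by (auto intro: integrable_norm)
  have "variance (\<lambda>x. cmod (f x)) = sqnorm M f - (expectation (\<lambda>x. cmod (f x)))\<^sup>2"
    using assms i by (intro variance_eq) (auto simp: square_integrable_def)
  then have "(expectation (\<lambda>x. cmod (f x)))\<^sup>2 \<le> sqnorm M f"
    using variance_positive[of "\<lambda>x. cmod (f x)"] by simp
  then show "integral\<^sup>L M (\<lambda>x. cmod (f x)) \<le> sqrt (sqnorm M f)"
    using real_le_rsqrt by blast
qed

text \<open>The geometric rate makes the increments summable in L1, so the sequence converges almost
  everywhere. Fatou's lemma then carries the bound on \<open>g m - g n\<close> over to the limit in
  \<open>m\<close>.\<close>

lemma (in prob_space) riesz_fischer:
  assumes sq: "\<And>n. square_integrable M (g n)"
    and cauchy: "\<And>n m. n \<le> m \<Longrightarrow> sqnorm M (\<lambda>x. g m x - g n x) \<le> (1/4) ^ n"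
  obtains h where "square_integrable M h" "\<And>n. sqnorm M (\<lambda>x. h x - g n x) \<le> (1/4) ^ n"
proof -
  have meas[measurable]: "g n \<in> borel_measurable M" for n
    using sq by (auto simp: square_integrable_def)
  have sqd: "square_integrable M (\<lambda>x. g m x - g n x)" for m n
    using sq by (intro square_integrable_diff)
  have step: "(\<integral>\<^sup>+x. ennreal (cmod (g (Suc n) x - g n x)) \<partial>M) \<le> ennreal ((1/2) ^ n)" for n
  proof -
    have "sqrt (sqnorm M (\<lambda>x. g (Suc n) x - g n x)) \<le> sqrt ((1/4)^n)"
      using cauchy[of n "Suc n"] by simp
    also have "\<dots> = (1/2)^n"
      by (simp add: real_sqrt_power real_sqrt_divide)
    finally show ?thesis
      using integral_cmod_le_sqrt_sqnorm[OF sqd, of "Suc n" n]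
      by (subst nn_integral_eq_integral) (auto intro: ennreal_leI)
  qed
  have "(\<integral>\<^sup>+x. (\<Sum>n. ennreal (cmod (g (Suc n) x - g n x))) \<partial>M)
      = (\<Sum>n. \<integral>\<^sup>+x. ennreal (cmod (g (Suc n) x - g n x)) \<partial>M)"
    by (intro nn_integral_suminf) auto
  also have "\<dots> \<le> (\<Sum>n. ennreal ((1/2) ^ n))"
    by (intro suminf_le step) auto
  also have "\<dots> < \<infinity>"
    by (subst suminf_ennreal2) (auto intro: summable_geometric)
  finally have "AE x in M. (\<Sum>n. ennreal (cmod (g (Suc n) x - g n x))) \<noteq> \<infinity>"
    by (intro nn_integral_noteq_infinite) auto
  then have conv: "AE x in M. (\<lambda>n. g n x) \<longlonglongrightarrow> lim (\<lambda>n. g n x)"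
  proof eventually_elim
    case (elim x)
    then have "summable (\<lambda>n. cmod (g (Suc n) x - g n x))"
      by (intro summable_suminf_not_top) auto
    then have "summable (\<lambda>n. g (Suc n) x - g n x)"
      by (rule summable_norm_cancel)
    then have "convergent (\<lambda>n. g n x)"
      by (simp add: summable_iff_convergent sum_lessThan_telescope[of "\<lambda>n. g n x"]
        convergent_diff_const_right_iff)
    then show ?case by (simp add: convergent_LIMSEQ_iff)
  qed
  define h where "h x = lim (\<lambda>n. g n x)" for x
  have hm[measurable]: "h \<in> borel_measurable M"
    unfolding h_def by measurable
  have nn: "(\<integral>\<^sup>+x. ennreal ((cmod (h x - g n x))\<^sup>2) \<partial>M) \<le> ennreal ((1/4) ^ n)" for n
  proof -
    have "(\<integral>\<^sup>+x. ennreal ((cmod (h x - g n x))\<^sup>2) \<partial>M)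
        = (\<integral>\<^sup>+x. liminf (\<lambda>m. ennreal ((cmod (g m x - g n x))\<^sup>2)) \<partial>M)"
    proof (rule nn_integral_cong_AE)
      show "AE x in M. ennreal ((cmod (h x - g n x))\<^sup>2)
          = liminf (\<lambda>m. ennreal ((cmod (g m x - g n x))\<^sup>2))"
        using conv
      proof eventually_elim
        case (elim x)
        then have "(\<lambda>m. g m x) \<longlonglongrightarrow> h x" by (simp add: h_def)
        then have "(\<lambda>m. ennreal ((cmod (g m x - g n x))\<^sup>2)) \<longlonglongrightarrow> ennreal ((cmod (h x - g n x))\<^sup>2)"
          by (intro tendsto_intros)
        then show ?case by (intro lim_imp_Liminf[symmetric]) auto
      qed
    qed
    also have "\<dots> \<le> liminf (\<lambda>m. \<integral>\<^sup>+x. ennreal ((cmod (g m x - g n x))\<^sup>2) \<partial>M)"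
      by (intro nn_integral_liminf) auto
    also have "\<dots> \<le> ennreal ((1/4) ^ n)"
    proof (rule Liminf_le)
      have "(\<integral>\<^sup>+x. ennreal ((cmod (g m x - g n x))\<^sup>2) \<partial>M) \<le> ennreal ((1/4) ^ n)" if "n \<le> m" for m
        using sqd[of m n] cauchy[OF that]
        by (subst nn_integral_eq_integral) (auto simp: square_integrable_def intro: ennreal_leI)
      then show "\<forall>\<^sub>F m in sequentially. (\<integral>\<^sup>+x. ennreal ((cmod (g m x - g n x))\<^sup>2) \<partial>M) \<le> ennreal ((1/4) ^ n)"
        by (auto simp: eventually_sequentially)
    qed simp
    finally show ?thesis .
  qed
  have sqh: "square_integrable M (\<lambda>x. h x - g n x)" for n
    unfolding square_integrable_def
  proof
    show "integrable M (\<lambda>x. (cmod (h x - g n x))\<^sup>2)"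
      using nn[of n] by (intro integrableI_bounded) (auto intro: le_less_trans)
  qed simp
  have "square_integrable M h"
    using square_integrable_add[OF sqh[of 0] sq[of 0]] by simp
  moreover have "sqnorm M (\<lambda>x. h x - g n x) \<le> (1/4) ^ n" for n
    using nn[of n] sqh[of n]
    by (subst (asm) nn_integral_eq_integral) (auto simp: square_integrable_def)
  ultimately show thesis by (rule that)
qed

text \<open>The partial sums over finite index sets whose energy approaches the supremum converge in
  \<open>L\<^sup>2\<close>; the limit has all Fourier coefficients of \<open>f\<close>, so it equals \<open>f\<close> by completeness.\<close>
lemma (in prob_space) parseval_approximation:
  assumes fam: "orthonormal_family M I e"
    and bdd: "\<And>i x. i \<in> I \<Longrightarrow> cmod (e i x) \<le> 1"
    and complete: "\<And>f. \<lbrakk>square_integrable M f; \<And>i. i \<in> I \<Longrightarrow> L2inner M f (e i) = 0\<rbrakk> \<Longrightarrow> AE x in M. f x = 0"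
    and f: "square_integrable M f" and s: "s < sqnorm M f"
  obtains F where "finite F" "F \<subseteq> I" "s < (\<Sum>i\<in>F. (cmod (L2inner M f (e i)))\<^sup>2)"
proof -
  interpret orthonormal_family M I e by (rule fam)
  define c where "c i = L2inner M f (e i)" for i
  define E where "E F = (\<Sum>i\<in>F. (cmod (c i))\<^sup>2)" for F
  define S where "S = Sup (E ` {F. finite F \<and> F \<subseteq> I})"
  have bd: "bdd_above (E ` {F. finite F \<and> F \<subseteq> I})"
    unfolding bdd_above_def E_def c_def using bessel[OF _ _ f] by auto
  have E_le: "E F \<le> S" if "finite F" "F \<subseteq> I" for F
    unfolding S_def using bd that by (intro cSup_upper) auto
  have "\<exists>F. finite F \<and> F \<subseteq> I \<and> S - (1/4)^n < E F" for n :: nat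
    using less_cSupD[of "E ` {F. finite F \<and> F \<subseteq> I}" "S - (1/4)^n"] by (auto simp: S_def[symmetric])
  then obtain G where G: "finite (G n)" "G n \<subseteq> I" "S - (1/4)^n < E (G n)" for n :: nat
    by metis
  define F where "F n = (\<Union>k\<le>n. G k)" for n
  have F: "finite (F n)" "F n \<subseteq> I" for n
    using G by (auto simp: F_def)
  have F_mono: "F n \<subseteq> F m" if "n \<le> m" for n m
    using that unfolding F_def by (intro UN_mono) auto
  have E_mono: "E A \<le> E B" if "A \<subseteq> B" "finite B" for A B
    unfolding E_def using that by (intro sum_mono2) auto
  have F_gt: "S - (1/4)^n < E (F n)" for n
    using G(3)[of n] E_mono[of "G n" "F n"] F by (force simp: F_def)
  \<comment> \<open>\<open>F n\<close> already captures the supremum \<open>S\<close> up to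
    \<open>(1/4)^n\<close>, and \<open>B \<union> F n\<close> cannot exceed \<open>S\<close>, so
    little energy remains outside \<open>F n\<close>.\<close>
  have E_diff: "E (B - F n) \<le> (1/4)^n" if "finite B" "B \<subseteq> I" for B n
  proof -
    have "E (B - F n) + E (F n) = E (B \<union> F n)"
      unfolding E_def using that F[of n]
      by (subst sum.union_disjoint[symmetric]) (auto simp: Un_commute)
    then show ?thesis using E_le[of "B \<union> F n"] that F[of n] F_gt[of n] by simp
  qed
  define g where "g n x = (\<Sum>i\<in>F n. c i * e i x)" for n x
  have sqg: "square_integrable M (g n)" for n
    unfolding g_def using F(2) by (rule square_integrable_combination)
  have diff: "sqnorm M (\<lambda>x. g m x - g n x) \<le> (1/4)^n" if "n \<le> m" for n m
  proof -
    have "g m x - g n x = (\<Sum>i\<in>F m - F n. c i * e i x)" for x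
      unfolding g_def using F F_mono[OF that] by (simp add: sum_diff)
    then have "sqnorm M (\<lambda>x. g m x - g n x) = E (F m - F n)"
      unfolding E_def using F by (subst sqnorm_combination[symmetric]) auto
    then show ?thesis using E_diff[of "F m" n] F by simp
  qed
  obtain h where h: "square_integrable M h" "\<And>n. sqnorm M (\<lambda>x. h x - g n x) \<le> (1/4)^n"
    using riesz_fischer[OF sqg diff] by metis
  have zero: "L2inner M (\<lambda>x. f x - h x) (e i) = 0" if i: "i \<in> I" for i
  proof -
    \<comment> \<open>One \<open>(1/2)^n\<close> bounds the L2 error between \<open>h\<close> and
      \<open>g n\<close>; the other bounds the coefficient of \<open>f\<close> at \<open>i\<close>
      in case \<open>i\<close> is not yet in \<open>F n\<close>.\<close>
    have bound: "cmod (L2inner M (\<lambda>x. f x - h x) (e i)) \<le> 2 * (1/2)^n" for n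
    proof -
      have sr: "sqrt ((1/4)^n) = (1/2)^n"
        by (simp add: real_sqrt_power real_sqrt_divide)
      have sqhg: "square_integrable M (\<lambda>x. h x - g n x)"
        using h(1) sqg by (rule square_integrable_diff)
      have int: "integrable M (\<lambda>x. (h x - g n x) * cnj (e i x))"
        using sqhg i by (intro square_integrable_times square_integrable_family)
      have "cmod (L2inner M (\<lambda>x. h x - g n x) (e i)) \<le> (LINT x|M. cmod ((h x - g n x) * cnj (e i x)))"
        unfolding L2inner_def by (rule integral_norm_bound)
      also have "\<dots> \<le> (LINT x|M. cmod (h x - g n x))"
        using integrable_norm[OF int] integral_cmod_le_sqrt_sqnorm(1)[OF sqhg] bdd[OF i]
        by (intro integral_mono) (auto simp: norm_mult mult_left_le)
      also have "\<dots> \<le> sqrt (sqnorm M (\<lambda>x. h x - g n x))"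
        by (rule integral_cmod_le_sqrt_sqnorm(2)[OF sqhg])
      also have "\<dots> \<le> (1/2)^n"
        using h(2)[of n] unfolding sr[symmetric] by simp
      finally have 1: "cmod (L2inner M h (e i) - L2inner M (g n) (e i)) \<le> (1/2)^n"
        using h(1) sqg i by (simp add: L2inner_diff_left square_integrable_family)
      have "(cmod (c i - L2inner M (g n) (e i)))\<^sup>2 \<le> E ({i} - F n)"
        unfolding g_def using F[of n] i by (auto simp: inner_combination E_def insert_Diff_if)
      also have "\<dots> \<le> (1/4)^n" using i by (intro E_diff) auto
      finally have 2: "cmod (c i - L2inner M (g n) (e i)) \<le> (1/2)^n"
        unfolding sr[symmetric] by (rule real_le_rsqrt)
      have "L2inner M (\<lambda>x. f x - h x) (e i) = c i - L2inner M h (e i)"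
        using f h(1) i by (simp add: c_def L2inner_diff_left square_integrable_family)
      also have "\<dots> = (c i - L2inner M (g n) (e i)) - (L2inner M h (e i) - L2inner M (g n) (e i))"
        by simp
      also have "cmod \<dots> \<le> (1/2)^n + (1/2)^n"
        using norm_triangle_ineq4 1 2 by (meson add_mono order_trans)
      finally show ?thesis by simp
    qed
    have "(\<lambda>n. 2 * (1/2)^n) \<longlonglongrightarrow> (2 * 0 :: real)"
      by (intro tendsto_intros LIMSEQ_power_zero) auto
    then have "cmod (L2inner M (\<lambda>x. f x - h x) (e i)) \<le> 0"
      using bound LIMSEQ_le_const by fastforce
    then show ?thesis by simp
  qed
  have "AE x in M. f x - h x = 0"
    using zero by (intro complete square_integrable_diff f h(1)) auto
  then have fh: "AE x in M. f x = h x" by simp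
  have "sqnorm M f - E (F n) \<le> (1/4)^n" for n
  proof -
    have "sqnorm M f - E (F n) = sqnorm M (\<lambda>x. f x - g n x)"
      using sqnorm_remainder[OF F f, of n] by (simp add: E_def c_def g_def)
    also have "\<dots> = sqnorm M (\<lambda>x. h x - g n x)"
      using f h(1) sqg[of n] fh
      by (intro integral_cong_AE) (auto simp: square_integrable_def)
    finally show ?thesis using h(2)[of n] by simp
  qed
  moreover obtain n where "(1/4::real)^n < sqnorm M f - s"
    using real_arch_pow_inv[of "sqnorm M f - s" "1/4"] s by auto
  ultimately have "s < E (F n)" by (smt (verit))
  then show thesis using that[OF F] by (simp add: E_def c_def)
qed

section \<open>Zeros of the Fourier transform and the counting bound\<close>

text \<open>All points lie in one coset \<open>x0 + q * z\<close> with \<open>z\<close> an integer.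
  Split them by the residue of \<open>z\<close> mod 3. Within one class the level
  \<open>j = 1\<close> is impossible, since it would make \<open>z x - z y\<close> equal to an
  integer prime to 3. Division by \<open>3 * q\<close> thus lowers all levels of the class by one,
  and the induction loses a factor 3.\<close>

lemma card_le_power3:
  fixes S :: "real set" and q :: int
  assumes q: "1 \<le> q"
    and "\<And>x y. \<lbrakk>x \<in> S; y \<in> S; x \<noteq> y\<rbrakk> \<Longrightarrow>
      \<exists>j\<in>{1..n}. \<exists>k::int. \<not> (3::int) dvd k \<and> x - y = (3 * real_of_int q) ^ j * real_of_int k / 3"
  shows "finite S \<and> card S \<le> 3 ^ n"
  using assms(2)
proof (induction n arbitrary: S)
  case 0
  then have "x = y" if "x \<in> S" "y \<in> S" for x y
    using that by fastforce
  then have "S = {} \<or> (\<exists>x. S = {x})" by blast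
  then show ?case by auto
next
  case (Suc n)
  show ?case
  proof (cases "S = {}")
    case False
    then obtain x0 where x0: "x0 \<in> S" by blast
    have int: "\<exists>z::int. x = x0 + q * z" if xS: "x \<in> S" for x
    proof (cases "x = x0")
      case False
      then obtain j k where j: "j \<in> {1..Suc n}" "x - x0 = (3 * real_of_int q) ^ j * real_of_int k / 3"
        using Suc.prems[of x x0] xS x0 by blast
      then obtain i where i: "j = Suc i" by (cases j) auto
      have "x = x0 + real_of_int (q * ((3 * q) ^ i * k))" using j(2) unfolding i by simp
      then show ?thesis by blast
    qed (auto intro: exI[of _ 0])
    then obtain z :: "real \<Rightarrow> int" where z: "\<And>x. x \<in> S \<Longrightarrow> x = x0 + q * z x"
      by metis
    define C where "C r = {x\<in>S. z x mod 3 = r}" for r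
    have C: "finite (C r) \<and> card (C r) \<le> 3 ^ n" for r
    proof -
      have inj: "inj_on (\<lambda>x. x / (3 * real_of_int q)) (C r)"
        using q by (auto simp: inj_on_def)
      have "finite ((\<lambda>x. x / (3 * real_of_int q)) ` C r) \<and> card ((\<lambda>x. x / (3 * real_of_int q)) ` C r) \<le> 3 ^ n"
      proof (rule Suc.IH)
        fix x' y' assume "x' \<in> (\<lambda>x. x / (3 * real_of_int q)) ` C r" "y' \<in> (\<lambda>x. x / (3 * real_of_int q)) ` C r" "x' \<noteq> y'"
        then obtain x y where x: "x \<in> C r" "x' = x / (3 * real_of_int q)" and y: "y \<in> C r" "y' = y / (3 * real_of_int q)" "x \<noteq> y"
          by auto
        have xy: "x \<in> S" "y \<in> S" using x y by (auto simp: C_def)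
        then obtain j k where j: "j \<in> {1..Suc n}" and k: "\<not> (3::int) dvd k" "x - y = (3 * real_of_int q) ^ j * real_of_int k / 3"
          using Suc.prems[of x y] y by blast
        obtain i where i: "j = Suc i" using j by (cases j) auto
        have "real_of_int q * (z x - z y) = x - y"
          using z[OF xy(1)] z[OF xy(2)] by (simp add: algebra_simps)
        also have "\<dots> = real_of_int q * real_of_int ((3 * q) ^ i * k)" using k(2) by (simp add: i)
        finally have "real_of_int (z x - z y) = real_of_int ((3 * q) ^ i * k)"
          using q by simp
        then have "z x - z y = (3 * q) ^ i * k" by linarith
        moreover have "3 dvd z x - z y"
          using x(1) y(1) mod_eq_dvd_iff[of "z x" 3 "z y"] by (auto simp: C_def)
        ultimately have "i \<noteq> 0" using k(1) by (cases i) auto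
        moreover have "x' - y' = (3 * real_of_int q) ^ i * real_of_int k / 3"
          using q k(2) x(2) y(2) by (simp add: i flip: diff_divide_distrib)
        ultimately show "\<exists>j\<in>{1..n}. \<exists>k::int. \<not> (3::int) dvd k \<and> x' - y' = (3 * real_of_int q) ^ j * real_of_int k / 3"
          using k(1) j i by (intro bexI[of _ i]) auto
      qed
      then show ?thesis using inj by (simp add: finite_image_iff card_image)
    qed
    have S: "S = (\<Union>r\<in>{0,1,2}. C r)"
    proof -
      have "z x mod 3 \<in> {0,1,2}" for x
        using pos_mod_sign[of 3 "z x"] pos_mod_bound[of 3 "z x"] by auto
      then show ?thesis by (auto simp: C_def)
    qed
    have "card S \<le> (\<Sum>r\<in>{0,1,2::int}. card (C r))"
      unfolding S by (rule card_UN_le) auto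
    also have "\<dots> \<le> (\<Sum>r\<in>{0,1,2::int}. 3 ^ n)"
      using C by (intro sum_mono) auto
    finally have "card S \<le> 3 ^ Suc n" by simp
    moreover have "finite S" unfolding S using C by auto
    ultimately show ?thesis by blast
  qed simp
qed

section \<open>Exponentials and the zeros of the digit mask\<close>

lemma expo_eq_cis: "expo l x = cis (- (2 * pi * (l \<bullet> x)))"
  by (simp add: expo_def cis_conv_exp mult_ac)

lemma norm_expo [simp]: "cmod (expo l x) = 1"
  by (simp add: expo_eq_cis)

lemma expo_add_left: "expo (k + l) x = expo k x * expo l x"
  by (simp add: expo_eq_cis cis_mult inner_left_distrib algebra_simps)

lemma cnj_expo: "cnj (expo l x) = expo (- l) x"
  by (simp add: expo_eq_cis cis_cnj)

lemma expo_0 [simp]: "expo 0 x = 1"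
  by (simp add: expo_eq_cis)

lemma borel_measurable_expo [measurable]: "expo l \<in> borel_measurable borel"
  unfolding expo_def by (intro borel_measurable_continuous_onI continuous_intros)

definition digit_mask :: "real^2 \<Rightarrow> complex" where
  "digit_mask \<xi> = (1 + cis (- (2 * pi * \<xi>$1)) + cis (- (2 * pi * \<xi>$2))) / 3"

lemma sum_expo_Sdigits: "(\<Sum>d\<in>Sdigits. expo \<xi> d) = 3 * digit_mask \<xi>"
proof -
  have "(vector [0,0] :: real^2) \<noteq> vector [1,0]" "(vector [0,0] :: real^2) \<noteq> vector [0,1]"
    "(vector [1,0] :: real^2) \<noteq> vector [0,1]"
    by (auto simp: vec_eq_iff forall_2)
  then show ?thesis
    by (simp add: Sdigits_def digit_mask_def expo_eq_cis inner_vec_def sum_2)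
qed

lemma card_Sdigits: "finite Sdigits" "card Sdigits = 3"
proof -
  have "(vector [0,0] :: real^2) \<noteq> vector [1,0]" "(vector [0,0] :: real^2) \<noteq> vector [0,1]"
    "(vector [1,0] :: real^2) \<noteq> vector [0,1]"
    by (auto simp: vec_eq_iff forall_2)
  then show "finite Sdigits" "card Sdigits = 3"
    by (simp_all add: Sdigits_def)
qed

text \<open>Real and imaginary parts express \<open>cos b\<close> and \<open>sin b\<close> through
  \<open>a\<close>; substituting them into the Pythagorean identity for \<open>b\<close> leaves a
  linear equation for \<open>cos a\<close>.\<close>

lemma cis_sum_zero:
  assumes "1 + cis a + cis b = 0"
  shows "cos a = - 1/2"
proof -
  have re: "1 + cos a + cos b = 0" and im: "sin a + sin b = 0"
    using assms by (auto simp: complex_eq_iff)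
  have "sin b = - sin a" "cos b = - 1 - cos a" using re im by linarith+
  then have "(- 1 - cos a)\<^sup>2 + (sin a)\<^sup>2 = 1"
    using sin_cos_squared_add[of b] by simp
  then have "(- 1 - cos a)\<^sup>2 + (1 - (cos a)\<^sup>2) = 1"
    by (simp add: sin_squared_eq)
  then show ?thesis by (simp add: power2_eq_square algebra_simps)
qed

lemma cos_eq_minus_half:
  assumes "cos (2 * pi * t) = - 1/2"
  obtains k :: int where "\<not> (3::int) dvd k" "t = real_of_int k / 3"
proof -
  have "cos (2 * pi * t) = cos (2 * pi / 3)"
    using assms cos_120 by simp
  then obtain n where "n \<in> \<int>" "2 * pi * t = 2 * pi / 3 + 2 * n * pi \<or> 2 * pi * t = - (2 * pi / 3) + 2 * n * pi"
    unfolding cos_eq by blast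
  then obtain m :: int where "2 * pi * t = 2 * pi * (1/3 + m) \<or> 2 * pi * t = 2 * pi * (- 1/3 + m)"
    by (auto elim!: Ints_cases simp: algebra_simps)
  then have "t = 1/3 + m \<or> t = - 1/3 + m"
    by simp
  then have "t = (3 * m + 1 :: int) / 3 \<or> t = (3 * m - 1 :: int) / 3"
    by auto
  moreover have "\<not> (3::int) dvd 3 * m + 1" "\<not> (3::int) dvd 3 * m - 1" by presburger+
  ultimately show thesis using that by blast
qed

lemma mask_eq_0:
  assumes "digit_mask \<xi> = 0"
  shows "\<exists>k::int. \<not> (3::int) dvd k \<and> \<xi>$i = real_of_int k / 3"
proof -
  have "1 + cis (- (2 * pi * \<xi>$1)) + cis (- (2 * pi * \<xi>$2)) = 0"
    "1 + cis (- (2 * pi * \<xi>$2)) + cis (- (2 * pi * \<xi>$1)) = 0"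
    using assms by (auto simp: digit_mask_def algebra_simps)
  then have "cos (2 * pi * \<xi>$1) = - 1/2" "cos (2 * pi * \<xi>$2) = - 1/2"
    using cis_sum_zero by fastforce+
  then have "cos (2 * pi * \<xi>$i) = - 1/2"
    using exhaust_2[of i] by auto
  then show ?thesis using cos_eq_minus_half by metis
qed

section \<open>The self-affine measure and its invariance for integrals\<close>

locale sierpinski =
  fixes q :: "2 \<Rightarrow> int" and \<mu> :: "(real^2) measure"
  assumes q_ge_1: "1 \<le> q i" and q_le: "q 1 \<le> q 2"
    and self_affine: "self_affine_measure (Amat (q 1) (q 2)) Sdigits \<mu>"

sublocale sierpinski \<subseteq> prob_space \<mu>
  using self_affine by (simp add: self_affine_measure_def)

context sierpinski
begin

lemma sets_mu [measurable_cong]: "sets \<mu> = sets borel"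
  using self_affine by (simp add: self_affine_measure_def)

lemma space_mu [simp]: "space \<mu> = UNIV"
  using sets_eq_imp_space_eq[OF sets_mu] by simp

lemma measure_self_affine:
  assumes "E \<in> sets borel"
  shows "measure \<mu> E = (1/3) * (\<Sum>d\<in>Sdigits. measure \<mu> ((\<lambda>x. Amat (q 1) (q 2) *v x - d) ` E))"
  using self_affine assms by (simp add: self_affine_measure_def)

text \<open>\<open>expand n\<close> and \<open>contract n\<close> are the \<open>n\<close>-th powers
  of the matrix and of its inverse, written coordinatewise so that no matrix algebra is needed;
  \<open>Amat_mult\<close> and \<open>Ainv_pow_eq\<close> make the link.\<close>

definition expand :: "nat \<Rightarrow> real^2 \<Rightarrow> real^2" where
  "expand n v = (\<chi> i. (3 * real_of_int (q i)) ^ n * v$i)"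

definition contract :: "nat \<Rightarrow> real^2 \<Rightarrow> real^2" where
  "contract n v = (\<chi> i. v$i / (3 * real_of_int (q i)) ^ n)"

lemma q_pos: "0 < real_of_int (q i)"
  using q_ge_1[of i] by simp

lemma q_nz [simp]: "q i \<noteq> 0"
  using q_ge_1[of i] by simp

lemma expand_nth [simp]: "expand n v $ i = (3 * real_of_int (q i)) ^ n * v$i"
  by (simp add: expand_def)

lemma contract_nth [simp]: "contract n v $ i = v$i / (3 * real_of_int (q i)) ^ n"
  by (simp add: contract_def)

lemma expand_contract [simp]: "expand n (contract n v) = v"
  by (simp add: vec_eq_iff)

lemma contract_expand [simp]: "contract n (expand n v) = v"
  by (simp add: vec_eq_iff)

lemma contract_add: "contract n (v + w) = contract n v + contract n w"
  by (simp add: vec_eq_iff add_divide_distrib)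

lemma contract_contract: "contract m (contract n v) = contract (m + n) v"
  by (simp add: vec_eq_iff power_add)

lemma contract_0 [simp]: "contract 0 v = v"
  by (simp add: vec_eq_iff)

lemma inner_contract: "contract n v \<bullet> w = v \<bullet> contract n w"
  by (simp add: inner_vec_def)

lemma Amat_mult: "Amat (q 1) (q 2) *v v = expand 1 v"
  by (simp add: vec_eq_iff Amat_def matrix_vector_mult_def sum_2 forall_2)

lemma Ainv_pow_eq: "Ainv_pow (Amat (q 1) (q 2)) n v = contract n v"
proof -
  let ?A = "Amat (q 1) (q 2)"
  let ?B = "\<chi> i j. if i = j then 1 / (3 * real_of_int (q i)) else 0"
  have "?A ** ?B = mat 1 \<and> ?B ** ?A = mat 1"
    by (simp add: vec_eq_iff matrix_matrix_mult_def Amat_def sum_2 forall_2 mat_def)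
  then have "?A ** matrix_inv ?A = mat 1"
    unfolding matrix_inv_def by (rule someI2) auto
  then have "expand 1 (matrix_inv ?A *v w) = w" for w
    unfolding Amat_mult[symmetric] by (simp add: matrix_vector_mul_assoc)
  then have inv: "matrix_inv ?A *v w = contract 1 w" for w
    by (metis contract_expand)
  show ?thesis
    unfolding Ainv_pow_def inv by (induction n) (simp_all add: contract_contract)
qed

text \<open>The preimage form makes measurability immediate and exhibits the three contractions
  \<open>y \<mapsto> contract 1 (y + d)\<close> of the iterated function system.\<close>

lemma image_Amat: "(\<lambda>x. Amat (q 1) (q 2) *v x - d) ` E = (\<lambda>y. contract 1 (y + d)) -` E"
  unfolding Amat_mult
proof (intro equalityI subsetI)
  fix y assume "y \<in> (\<lambda>y. contract 1 (y + d)) -` E"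
  then show "y \<in> (\<lambda>x. expand 1 x - d) ` E"
    by (intro image_eqI[of _ _ "contract 1 (y + d)"]) (simp_all del: One_nat_def)
qed (auto simp del: One_nat_def)

lemma continuous_contract: "continuous_on S (contract n)"
  unfolding contract_def by (intro continuous_intros) auto

lemma borel_measurable_contract [measurable]: "contract n \<in> borel_measurable borel"
  by (intro borel_measurable_continuous_onI continuous_contract)

lemma measurable_branch [measurable]:
  "(\<lambda>(d, y). contract n (y + d)) \<in> borel_measurable (measure_pmf (pmf_of_set Sdigits) \<Otimes>\<^sub>M \<mu>)"
proof -
  \<comment> \<open>The first factor carries the discrete sigma-algebra, so the identity into the
    Borel space is measurable and the digit can be used as a Borel vector.\<close>
  have id: "(\<lambda>d. d) \<in> measurable (measure_pmf (pmf_of_set Sdigits)) borel" by simp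
  show ?thesis
    using measurable_compose[OF measurable_fst id, of \<mu>] by measurable
qed

text \<open>Probabilistic form of self-affinity: a uniformly random digit and an independent point
  with law \<open>\<mu>\<close> combine to a point with law \<open>\<mu>\<close> again. Unlike the
  identity for sets, this form passes directly to integrals.\<close>

lemma distr_self_affine:
  "distr (measure_pmf (pmf_of_set Sdigits) \<Otimes>\<^sub>M \<mu>) borel (\<lambda>(d, y). contract 1 (y + d)) = \<mu>" (is "?N = \<mu>")
proof (rule measure_eqI)
  show "sets ?N = sets \<mu>" by (simp add: sets_mu)
  fix E assume "E \<in> sets ?N"
  then have E[measurable]: "E \<in> sets borel" by simp
  interpret P: pair_prob_space "measure_pmf (pmf_of_set Sdigits)" \<mu>
    by unfold_locales
  have "emeasure ?N E = emeasure (measure_pmf (pmf_of_set Sdigits) \<Otimes>\<^sub>M \<mu>)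
      ((\<lambda>(d, y). contract 1 (y + d)) -` E \<inter> space (measure_pmf (pmf_of_set Sdigits) \<Otimes>\<^sub>M \<mu>))"
    by (subst emeasure_distr) auto
  also have "\<dots> = (\<integral>\<^sup>+d. emeasure \<mu> (Pair d -` ((\<lambda>(d, y). contract 1 (y + d)) -` E \<inter> space (measure_pmf (pmf_of_set Sdigits) \<Otimes>\<^sub>M \<mu>))) \<partial>measure_pmf (pmf_of_set Sdigits))"
    by (subst emeasure_pair_measure_alt) auto
  also have "\<dots> = (\<integral>\<^sup>+d. emeasure \<mu> ((\<lambda>y. contract 1 (y + d)) -` E) \<partial>measure_pmf (pmf_of_set Sdigits))"
    by (auto intro!: nn_integral_cong arg_cong2[where f=emeasure] simp: space_pair_measure)
  also have "\<dots> = (\<Sum>d\<in>Sdigits. emeasure \<mu> ((\<lambda>y. contract 1 (y + d)) -` E)) / card Sdigits"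
    using card_Sdigits by (intro nn_integral_pmf_of_set) auto
  also have "\<dots> = ennreal ((\<Sum>d\<in>Sdigits. measure \<mu> ((\<lambda>y. contract 1 (y + d)) -` E)) / 3)"
    using card_Sdigits by (simp add: emeasure_eq_measure divide_ennreal[symmetric] sum_nonneg)
  also have "(\<Sum>d\<in>Sdigits. measure \<mu> ((\<lambda>y. contract 1 (y + d)) -` E)) / 3 = measure \<mu> E"
    using measure_self_affine[OF E] unfolding image_Amat by simp
  also have "ennreal (measure \<mu> E) = emeasure \<mu> E"
    by (simp add: emeasure_eq_measure)
  finally show "emeasure ?N E = emeasure \<mu> E" .
qed

text \<open>Change of variables along \<open>distr_self_affine\<close>, followed by Fubini; the
  bound \<open>K\<close> gives integrability on the product.\<close>

lemma integral_self_affine: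
  fixes f :: "real^2 \<Rightarrow> complex"
  assumes [measurable]: "f \<in> borel_measurable borel" and bd: "\<And>x. cmod (f x) \<le> K"
  shows "integral\<^sup>L \<mu> f = (\<Sum>d\<in>Sdigits. LINT y|\<mu>. f (contract 1 (y + d))) / 3"
proof -
  interpret P: pair_prob_space "measure_pmf (pmf_of_set Sdigits)" \<mu>
    by unfold_locales
  have "integral\<^sup>L \<mu> f = (LINT p|(measure_pmf (pmf_of_set Sdigits) \<Otimes>\<^sub>M \<mu>). f (case p of (d, y) \<Rightarrow> contract 1 (y + d)))"
    by (subst distr_self_affine[symmetric], subst integral_distr) auto
  also have "\<dots> = (LINT d|measure_pmf (pmf_of_set Sdigits). LINT y|\<mu>. f (contract 1 (y + d)))"
    using bd by (subst P.integral_fst'[symmetric]) (auto intro!: P.P.integrable_const_bound[of _ K])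
  also have "\<dots> = (\<Sum>d\<in>Sdigits. (1/3) *\<^sub>R (LINT y|\<mu>. f (contract 1 (y + d))))"
  proof (subst integral_measure_pmf[of Sdigits])
    have "Sdigits \<noteq> {}" using card_Sdigits by auto
    then have "pmf (pmf_of_set Sdigits) d = 1/3" if "d \<in> Sdigits" for d
      using that card_Sdigits by simp
    then show "(\<Sum>d\<in>Sdigits. pmf (pmf_of_set Sdigits) d *\<^sub>R (LINT y|\<mu>. f (contract 1 (y + d))))
      = (\<Sum>d\<in>Sdigits. (1/3) *\<^sub>R (LINT y|\<mu>. f (contract 1 (y + d))))"
      by (intro sum.cong refl) (simp only:)
    show "d \<in> Sdigits" if "d \<in> set_pmf (pmf_of_set Sdigits)" for d
      using that \<open>Sdigits \<noteq> {}\<close> card_Sdigits by simp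
  qed (rule card_Sdigits)
  also have "\<dots> = (\<Sum>d\<in>Sdigits. (LINT y|\<mu>. f (contract 1 (y + d))) / 3)"
    by (intro sum.cong refl) (simp add: scaleR_conv_of_real)
  finally show ?thesis
    by (simp only: sum_divide_distrib)
qed

section \<open>The Fourier transform, its product formula and its zeros\<close>

definition ft :: "real^2 \<Rightarrow> complex" where
  "ft \<xi> = integral\<^sup>L \<mu> (expo \<xi>)"

lemma ft_refine: "ft \<xi> = digit_mask (contract 1 \<xi>) * ft (contract 1 \<xi>)"
proof -
  have "ft \<xi> = (\<Sum>d\<in>Sdigits. LINT y|\<mu>. expo \<xi> (contract 1 (y + d))) / 3"
    unfolding ft_def by (rule integral_self_affine[where K=1]) auto
  also have "\<dots> = (\<Sum>d\<in>Sdigits. LINT y|\<mu>. expo (contract 1 \<xi>) d * expo (contract 1 \<xi>) y) / 3"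
    by (simp add: expo_eq_cis inner_contract[symmetric] inner_right_distrib cis_mult algebra_simps)
  also have "\<dots> = (\<Sum>d\<in>Sdigits. expo (contract 1 \<xi>) d) * ft (contract 1 \<xi>) / 3"
    by (simp add: ft_def sum_distrib_right)
  finally show ?thesis by (simp add: sum_expo_Sdigits)
qed

text \<open>The product of the masks at \<open>contract j \<xi>\<close> for
  \<open>j = 1, ..., n\<close>. It is the Fourier transform of the law of the \<open>n\<close>-digit
  partial sums of the random expansion.\<close>

primrec mask_prod :: "nat \<Rightarrow> real^2 \<Rightarrow> complex" where
  "mask_prod 0 \<xi> = 1"
| "mask_prod (Suc n) \<xi> = digit_mask (contract 1 \<xi>) * mask_prod n (contract 1 \<xi>)"

lemma ft_eq_mask_prod: "ft \<xi> = mask_prod n \<xi> * ft (contract n \<xi>)"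
proof (induction n arbitrary: \<xi>)
  case (Suc n)
  show ?case
    using ft_refine[of \<xi>] Suc[of "contract 1 \<xi>"] by (simp add: contract_contract)
qed simp

lemma mask_prod_eq_0:
  "mask_prod n \<xi> = 0 \<Longrightarrow> \<exists>j\<in>{1..n}. digit_mask (contract j \<xi>) = 0"
proof (induction n arbitrary: \<xi>)
  case (Suc n)
  then consider "digit_mask (contract 1 \<xi>) = 0" | "mask_prod n (contract 1 \<xi>) = 0" by auto
  then show ?case
  proof cases
    case 2
    then obtain j where "j \<in> {1..n}" "digit_mask (contract j (contract 1 \<xi>)) = 0"
      using Suc.IH by blast
    then show ?thesis by (intro bexI[of _ "Suc j"]) (auto simp: contract_contract)
  qed (auto intro: bexI[of _ 1])
qed simp

lemma contract_tendsto_0: "(\<lambda>n. contract n \<xi>) \<longlonglongrightarrow> 0"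
proof (rule vec_tendstoI)
  fix i
  have "(\<lambda>n. \<xi>$i * (1 / (3 * real_of_int (q i))) ^ n) \<longlonglongrightarrow> \<xi>$i * 0"
    using q_ge_1[of i] by (intro tendsto_intros LIMSEQ_power_zero) auto
  moreover have "contract n \<xi> $ i = \<xi>$i * (1 / (3 * real_of_int (q i))) ^ n" for n
    by (simp add: power_divide)
  ultimately show "(\<lambda>n. contract n \<xi> $ i) \<longlonglongrightarrow> 0 $ i"
    by simp
qed

lemma ft_contract_tendsto: "(\<lambda>n. ft (contract n \<xi>)) \<longlonglongrightarrow> 1"
proof -
  have "(\<lambda>n. ft (contract n \<xi>)) \<longlonglongrightarrow> (LINT x|\<mu>. 1)"
    unfolding ft_def
  proof (rule integral_dominated_convergence[where w="\<lambda>_. 1"])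
    show "AE x in \<mu>. (\<lambda>n. expo (contract n \<xi>) x) \<longlonglongrightarrow> 1"
    proof (rule AE_I2)
      fix x
      have "(\<lambda>n. expo (contract n \<xi>) x) \<longlonglongrightarrow> exp (- (2 * pi * \<i>) * complex_of_real (0 \<bullet> x))"
        unfolding expo_def by (intro tendsto_intros contract_tendsto_0)
      then show "(\<lambda>n. expo (contract n \<xi>) x) \<longlonglongrightarrow> 1" by simp
    qed
  qed auto
  then show ?thesis using prob_space by simp
qed

text \<open>Since \<open>ft (contract n \<xi>)\<close> tends to 1, a zero of \<open>ft\<close> must
  come from one of finitely many mask factors. That factor fixes a single level \<open>j\<close>,
  common to both coordinates.\<close>

lemma ft_eq_0:
  assumes "ft \<xi> = 0"
  obtains j where "1 \<le> j" "\<And>i. \<exists>k::int. \<not> (3::int) dvd k \<and> \<xi>$i = (3 * real_of_int (q i)) ^ j * real_of_int k / 3"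
proof -
  have "\<forall>\<^sub>F n in sequentially. ft (contract n \<xi>) \<noteq> 0"
    using ft_contract_tendsto by (rule tendsto_imp_eventually_ne) simp
  then obtain n where "ft (contract n \<xi>) \<noteq> 0"
    by (auto simp: eventually_sequentially)
  then have "mask_prod n \<xi> = 0" using assms ft_eq_mask_prod[of \<xi> n] by simp
  then obtain j where j: "1 \<le> j" "digit_mask (contract j \<xi>) = 0"
    using mask_prod_eq_0 by fastforce
  show thesis
  proof (rule that[OF j(1)])
    fix i
    show "\<exists>k::int. \<not> (3::int) dvd k \<and> \<xi>$i = (3 * real_of_int (q i)) ^ j * real_of_int k / 3"
    proof -
      obtain k :: int where k: "\<not> 3 dvd k" "contract j \<xi> $ i = real_of_int k / 3"
        using mask_eq_0[OF j(2)] by blast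
      then have "\<xi>$i = (3 * real_of_int (q i)) ^ j * (real_of_int k / 3)"
        by (metis expand_contract expand_nth)
      with k(1) show ?thesis by auto
    qed
  qed
qed

lemma L2inner_expo: "L2inner \<mu> (expo k) (expo l) = ft (k - l)"
  unfolding L2inner_def ft_def cnj_expo by (simp flip: expo_add_left)

text \<open>The second coordinate, with the larger expansion, limits the levels \<open>j\<close> of
  differences in the ball; the first coordinate, with the smaller one, then counts the points
  through \<open>card_le_power3\<close>.\<close>

lemma card_orthogonal_ball:
  assumes orth: "orthogonal_set \<mu> \<Lambda>" and h: "2 * h \<le> (3 * real_of_int (q 2)) ^ n"
  shows "finite (\<Lambda> \<inter> ball x h)" "card (\<Lambda> \<inter> ball x h) \<le> 3 ^ n"
proof -
  let ?L = "\<Lambda> \<inter> ball x h"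
  have diff: "\<exists>j\<in>{1..n}. \<exists>k::int. \<not> (3::int) dvd k \<and> (l - g)$1 = (3 * real_of_int (q 1)) ^ j * real_of_int k / 3"
    if lg: "l \<in> ?L" "g \<in> ?L" "l \<noteq> g" for l g
  proof -
    have "ft (l - g) = 0"
      using orth lg by (auto simp: orthogonal_set_def L2inner_expo)
    then obtain j where j: "1 \<le> j" "\<And>i. \<exists>k::int. \<not> (3::int) dvd k \<and> (l - g)$i = (3 * real_of_int (q i)) ^ j * real_of_int k / 3"
      using ft_eq_0 by blast
    obtain k :: int where k: "\<not> (3::int) dvd k" "(l - g)$2 = (3 * real_of_int (q 2)) ^ j * real_of_int k / 3" using j(2) by blast
    have "k \<noteq> 0" using k(1) by auto
    then have "1 \<le> \<bar>k\<bar>" by simp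
    then have k1: "1 \<le> \<bar>real_of_int k\<bar>" by (metis of_int_1_le_iff of_int_abs)
    have "\<bar>(l - g)$2\<bar> \<le> norm (l - g)" by (rule component_le_norm_cart)
    also have "\<dots> \<le> dist x l + dist x g"
      using dist_triangle2[of l g x] by (simp add: dist_norm norm_minus_commute)
    also have "\<dots> < 2 * h" using lg by simp
    finally have lt: "\<bar>(l - g)$2\<bar> < (3 * real_of_int (q 2)) ^ n" using h by simp
    \<comment> \<open>A level above \<open>n\<close> separates second coordinates by at least
      \<open>(3 * q 2) ^ (n + 1) / 3\<close>, that is \<open>q 2 * (3 * q 2) ^ n\<close>, which is
      too much for two points of the ball.\<close>
    have "j \<le> n"
    proof (rule ccontr)
      assume "\<not> j \<le> n"
      then have "Suc n \<le> j" by simp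
      then have "(3 * real_of_int (q 2)) ^ Suc n \<le> (3 * real_of_int (q 2)) ^ j"
        using q_ge_1[of 2] by (intro power_increasing) auto
      then have "(3 * real_of_int (q 2)) ^ Suc n * 1 \<le> (3 * real_of_int (q 2)) ^ j * \<bar>real_of_int k\<bar>"
        using k1 q_pos[of 2] by (intro mult_mono) auto
      also have "\<dots> = 3 * \<bar>(l - g)$2\<bar>"
        unfolding k(2) using q_pos[of 2] by (simp add: abs_mult)
      finally have "real_of_int (q 2) * (3 * real_of_int (q 2)) ^ n \<le> \<bar>(l - g)$2\<bar>" by simp
      moreover have "1 * (3 * real_of_int (q 2)) ^ n \<le> real_of_int (q 2) * (3 * real_of_int (q 2)) ^ n"
        using q_ge_1[of 2] by (intro mult_right_mono) auto
      ultimately show False using lt by linarith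
    qed
    then show ?thesis using j by (metis atLeastAtMost_iff)
  qed
  \<comment> \<open>A zero of \<open>ft\<close> has no vanishing coordinate, as its integer factors
    are prime to 3. Hence the projection loses no points.\<close>
  have inj: "inj_on (\<lambda>v. v$1) ?L"
  proof (rule inj_onI, rule ccontr)
    fix l g assume lg: "l \<in> ?L" "g \<in> ?L" "l$1 = g$1" "l \<noteq> g"
    then obtain j k where "\<not> (3::int) dvd k" "(l - g)$1 = (3 * real_of_int (q 1)) ^ j * real_of_int k / 3"
      using diff by blast
    then show False using lg(3) by simp
  qed
  have "finite ((\<lambda>v. v$1) ` ?L) \<and> card ((\<lambda>v. v$1) ` ?L) \<le> 3 ^ n"
  proof (rule card_le_power3[OF q_ge_1[of 1]])
    fix a b assume "a \<in> (\<lambda>v. v$1) ` ?L" "b \<in> (\<lambda>v. v$1) ` ?L" "a \<noteq> b"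
    then obtain l g where lg: "l \<in> ?L" "g \<in> ?L" "a = l$1" "b = g$1" "a \<noteq> b"
      by blast
    then have "l \<noteq> g" by blast
    with diff[OF lg(1,2)] lg(3,4) show "\<exists>j\<in>{1..n}. \<exists>k::int. \<not> (3::int) dvd k \<and> a - b = (3 * real_of_int (q 1)) ^ j * real_of_int k / 3"
      by simp
  qed
  then show "finite ?L" "card ?L \<le> 3 ^ n"
    using inj by (auto simp: finite_image_iff card_image)
qed

end

section \<open>Beurling dimension and sampling of the mask\<close>

text \<open>For every \<open>r > a\<close> the normalised count is at most
  \<open>K * h powr (a - r)\<close>, which tends to 0, so \<open>r\<close> competes in the
  infimum.\<close>

lemma beurling_dim_le:
  assumes "0 < a" "0 < K"
    and count: "\<And>x h. 1 \<le> h \<Longrightarrow> ecard (\<Lambda> \<inter> ball x h) \<le> ereal (K * h powr a)"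
  shows "beurling_dim \<Lambda> \<le> ereal a"
proof -
  have zero: "upper_beurling_density r \<Lambda> = 0" if r: "a < r" for r
  proof -
    have "(\<Squnion>x. ecard (\<Lambda> \<inter> ball x h) / ereal (h powr r)) \<le> ereal (K * h powr (a - r))" if h: "1 \<le> h" for h
    proof (rule SUP_least)
      fix x
      have "ecard (\<Lambda> \<inter> ball x h) / ereal (h powr r) \<le> ereal (K * h powr a) / ereal (h powr r)"
        using h by (intro ereal_divide_right_mono count) auto
      also have "\<dots> = ereal (K * h powr (a - r))"
        using h by (simp add: powr_diff)
      finally show "ecard (\<Lambda> \<inter> ball x h) / ereal (h powr r) \<le> ereal (K * h powr (a - r))" .
    qed
    then have "upper_beurling_density r \<Lambda> \<le> Limsup at_top (\<lambda>h. ereal (K * h powr (a - r)))"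
      unfolding upper_beurling_density_def
      by (intro Limsup_mono eventually_mono[OF eventually_ge_at_top[of 1]])
    also have "\<dots> = 0"
    proof (rule lim_imp_Limsup)
      have "((\<lambda>h. K * h powr (a - r)) \<longlongrightarrow> K * 0) at_top"
        using r by (intro tendsto_intros tendsto_neg_powr filterlim_ident) auto
      then show "((\<lambda>h. ereal (K * h powr (a - r))) \<longlongrightarrow> 0) at_top"
        unfolding zero_ereal_def by (intro tendsto_ereal) simp
    qed simp
    finally have "upper_beurling_density r \<Lambda> \<le> 0" .
    moreover have "0 \<le> upper_beurling_density r \<Lambda>"
      unfolding upper_beurling_density_def
    proof (rule le_Limsup)
      \<comment> \<open>The centre \<open>undefined\<close> stands for an arbitrary point: a
        supremum dominates any one of its terms, and all terms are nonnegative.\<close>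
      have "0 \<le> (\<Squnion>x. ecard (\<Lambda> \<inter> ball x h) / ereal (h powr r))" if "1 \<le> h" for h
        by (rule SUP_upper2[of undefined]) (auto simp: ecard_def intro!: zero_le_divide_ereal)
      then show "\<forall>\<^sub>F h in at_top. 0 \<le> (\<Squnion>x. ecard (\<Lambda> \<inter> ball x h) / ereal (h powr r))"
        by (intro eventually_mono[OF eventually_ge_at_top[of 1]])
    qed simp
    ultimately show ?thesis by simp
  qed
  show ?thesis
  \<comment> \<open>Density 0 is known only strictly above \<open>a\<close>, so \<open>a\<close> is
    approached from above.\<close>
  proof (rule dense_ge)
    fix z assume "ereal a < z"
    then show "beurling_dim \<Lambda> \<le> z"
    proof (cases z)
      case (real r)
      then have "r \<in> {r. r > 0 \<and> upper_beurling_density r \<Lambda> = 0}"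
        using \<open>ereal a < z\<close> assms(1) zero by auto
      then show ?thesis unfolding beurling_dim_def real by (intro Inf_lower imageI)
    qed auto
  qed
qed

text \<open>A zero density at some \<open>r < a\<close> would push the normalised count below
  \<open>\<delta>\<close> for all large radii. Large counts along one unbounded sequence of radii
  already contradict this.\<close>

lemma beurling_dim_ge:
  assumes "0 < \<delta>"
    and lim: "filterlim h at_top sequentially"
    and count: "\<And>n::nat. \<exists>x. ereal (\<delta> * h n powr a) \<le> ecard (\<Lambda> \<inter> ball x (h n))"
  shows "ereal a \<le> beurling_dim \<Lambda>"
  unfolding beurling_dim_def
proof (rule INF_greatest, clarsimp, rule ccontr)
  fix r assume "0 < r" and zero: "upper_beurling_density r \<Lambda> = 0" and "\<not> a \<le> r"
  then have "Limsup at_top (\<lambda>h. SUP x. ecard (\<Lambda> \<inter> ball x h) / ereal (h powr r)) < ereal \<delta>"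
    using assms(1) by (simp add: upper_beurling_density_def)
  then have "\<forall>\<^sub>F h in at_top. (SUP x. ecard (\<Lambda> \<inter> ball x h) / ereal (h powr r)) < ereal \<delta>"
    by (rule Limsup_lessD)
  then have "\<forall>\<^sub>F h in at_top. (SUP x. ecard (\<Lambda> \<inter> ball x h) / ereal (h powr r)) < ereal \<delta> \<and> 1 \<le> h"
    by (intro eventually_conj eventually_ge_at_top)
  then have "\<forall>\<^sub>F n in sequentially. (SUP x. ecard (\<Lambda> \<inter> ball x (h n)) / ereal (h n powr r)) < ereal \<delta> \<and> 1 \<le> h n"
    using lim unfolding filterlim_iff by blast
  then obtain n where n: "(SUP x. ecard (\<Lambda> \<inter> ball x (h n)) / ereal (h n powr r)) < ereal \<delta>" "1 \<le> h n"
    by (auto simp: eventually_sequentially)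
  obtain x where x: "ereal (\<delta> * h n powr a) \<le> ecard (\<Lambda> \<inter> ball x (h n))"
    using count by blast
  have "\<delta> * h n powr r \<le> \<delta> * h n powr a"
    using n(2) assms(1) \<open>\<not> a \<le> r\<close> by (intro mult_left_mono powr_mono) auto
  then have "\<delta> \<le> \<delta> * h n powr a / h n powr r"
    using n(2) by (simp add: pos_le_divide_eq)
  then have "ereal \<delta> \<le> ereal (\<delta> * h n powr a) / ereal (h n powr r)"
    using n(2) by simp
  also have "\<dots> \<le> ecard (\<Lambda> \<inter> ball x (h n)) / ereal (h n powr r)"
    using n(2) by (intro ereal_divide_right_mono x) auto
  also have "\<dots> \<le> (SUP x. ecard (\<Lambda> \<inter> ball x (h n)) / ereal (h n powr r))"
    by (rule SUP_upper) simp
  finally show False using n(1) by simp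
qed

text \<open>The rows \<open>(1, 1, 1)\<close>, \<open>(1, cnj w, w)\<close> and
  \<open>(1, w, cnj w)\<close> form the Fourier matrix of order 3, which is \<open>sqrt 3\<close>
  times a unitary matrix. Applied to \<open>(1, p, q)\<close>, of squared norm 3, it gives squared
  norm 9.\<close>

lemma sum_sqnorm_rotations:
  fixes p q w :: complex
  assumes "cmod p = 1" "cmod q = 1" "w = cis (2 * pi / 3)"
  shows "(cmod (1 + p + q))\<^sup>2 + (cmod (1 + cnj w * p + w * q))\<^sup>2 + (cmod (1 + w * p + cnj w * q))\<^sup>2 = 9"
proof -
  obtain a b c d where pq: "p = Complex a b" "q = Complex c d" by (metis complex.exhaust)
  have 1: "a\<^sup>2 + b\<^sup>2 = 1" "c\<^sup>2 + d\<^sup>2 = 1"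
    using assms(1,2) by (auto simp: pq cmod_def)
  have w: "Re w = -1/2" "Im w = sqrt 3 / 2"
    using assms(3) cos_120 sin_120 by auto
  define s where "s = sqrt (3::real)"
  have s: "s\<^sup>2 = 3" by (simp add: s_def)
  have "(cmod (1 + p + q))\<^sup>2 + (cmod (1 + cnj w * p + w * q))\<^sup>2 + (cmod (1 + w * p + cnj w * q))\<^sup>2
     = (1 + a + c)\<^sup>2 + (b + d)\<^sup>2
     + ((1 - a/2 + s*b/2 - c/2 - s*d/2)\<^sup>2 + (- b/2 - s*a/2 - d/2 + s*c/2)\<^sup>2)
     + ((1 - a/2 - s*b/2 - c/2 + s*d/2)\<^sup>2 + (- b/2 + s*a/2 - d/2 - s*c/2)\<^sup>2)"
    unfolding cmod_power2 by (simp add: pq w s_def[symmetric] algebra_simps)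
  \<comment> \<open>With \<open>s\<close> kept symbolic the cross terms collect into a multiple of
    \<open>3 - s\<^sup>2\<close>, which vanishes for \<open>s = sqrt 3\<close>.\<close>
  also have "\<dots> = 3 + (3/2) * (a\<^sup>2 + b\<^sup>2) + (3/2) * (c\<^sup>2 + d\<^sup>2) + (s\<^sup>2/2) * (a\<^sup>2 + b\<^sup>2) + (s\<^sup>2/2) * (c\<^sup>2 + d\<^sup>2)
     + (3 - s\<^sup>2) * (a * c + b * d)"
    by (simp add: power2_eq_square field_simps)
  finally show ?thesis by (simp add: 1 s)
qed

text \<open>Together with the digits, the multiples by -1, 0 and 1 produce the Fourier matrix of
  order 3. The matrix maps this vector to the integer vector \<open>(q 1, - q 2)\<close>.\<close>

definition third_shift :: "real^2" where
  "third_shift = vector [1/3, -1/3]"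

text \<open>Each shift multiplies the two exponentials by conjugate cube roots of unity, so
  \<open>sum_sqnorm_rotations\<close> applies. In other words, the three shifts form a spectrum of
  the uniform measure on the digits.\<close>

lemma sum_digit_mask_shift:
  "(\<Sum>a\<in>{-1,0,1::int}. (cmod (digit_mask (\<eta> + of_int a *\<^sub>R third_shift)))\<^sup>2) = 1"
proof -
  define p where "p = cis (- (2 * pi * \<eta>$1))"
  define q where "q = cis (- (2 * pi * \<eta>$2))"
  define w where "w = cis (2 * pi / 3)"
  have m: "digit_mask (\<eta> + of_int 0 *\<^sub>R third_shift) = (1 + p + q) / 3"
    "digit_mask (\<eta> + of_int 1 *\<^sub>R third_shift) = (1 + cnj w * p + w * q) / 3"
    "digit_mask (\<eta> + of_int (-1) *\<^sub>R third_shift) = (1 + w * p + cnj w * q) / 3"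
    by (simp_all add: digit_mask_def third_shift_def p_def q_def w_def cis_cnj cis_mult algebra_simps)
  have sum3: "(\<Sum>a\<in>{-1,0,1::int}. F a) = F 0 + F 1 + F (-1)" for F :: "int \<Rightarrow> real"
    by simp
  have "(cmod ((1 + p + q) / 3))\<^sup>2 + (cmod ((1 + cnj w * p + w * q) / 3))\<^sup>2 + (cmod ((1 + w * p + cnj w * q) / 3))\<^sup>2 = 1"
    using sum_sqnorm_rotations[of p q w] by (simp add: p_def q_def w_def norm_divide power_divide)
  then show ?thesis unfolding sum3 m .
qed

lemma digit_mask_periodic:
  assumes "v$1 \<in> \<int>" "v$2 \<in> \<int>"
  shows "digit_mask (v + \<eta>) = digit_mask \<eta>"
proof -
  have "cis (- (2 * pi * (v + \<eta>)$i)) = cis (- (2 * pi * \<eta>$i))" if "v$i \<in> \<int>" for i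
  proof -
    have "cis (- (2 * pi * (v + \<eta>)$i)) = cis (2 * pi * (- v$i)) * cis (- (2 * pi * \<eta>$i))"
      by (simp add: cis_mult algebra_simps)
    also have "cis (2 * pi * (- v$i)) = 1" using that by (intro cis_multiple_2pi) auto
    finally show ?thesis by simp
  qed
  then show ?thesis using assms by (simp add: digit_mask_def)
qed

definition digit_words :: "nat \<Rightarrow> int list set" where
  "digit_words n = {as. set as \<subseteq> {-1,0,1} \<and> length as = n}"

lemma finite_digit_words: "finite (digit_words n)"
  and card_digit_words: "card (digit_words n) = 3 ^ n"
  unfolding digit_words_def using card_lists_length_eq[of "{-1,0,1::int}" n] finite_lists_length_eq[of "{-1,0,1::int}" n]
  by (auto simp: numeral_3_eq_3)

lemma digit_words_Suc: "digit_words (Suc n) = (\<lambda>(a, as). a # as) ` ({-1,0,1} \<times> digit_words n)"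
  unfolding digit_words_def by (auto simp: length_Suc_conv image_iff)

section \<open>Integer frequencies that sample the mask products\<close>

context sierpinski
begin

text \<open>A word \<open>a_1, ..., a_n\<close> is sent to the sum of
  \<open>expand k (a_k *\<^sub>R third_shift)\<close> over \<open>k = 1, ..., n\<close>.\<close>

primrec word_point :: "int list \<Rightarrow> real^2" where
  "word_point [] = 0"
| "word_point (a # as) = expand 1 (word_point as + of_int a *\<^sub>R third_shift)"

lemma word_point_Ints: "word_point as $ i \<in> \<int>"
proof (induction as)
  case (Cons a as)
  have "word_point (a # as) $ i = of_int (3 * q i) * word_point as $ i + of_int (q i * a) * (3 * third_shift$i)"
    by (simp add: algebra_simps)
  moreover have "3 * third_shift $ i \<in> \<int>"
    using exhaust_2[of i] by (auto simp: third_shift_def)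
  ultimately show ?case using Cons by (metis Ints_add Ints_mult Ints_of_int)
qed simp

text \<open>By integrality of \<open>word_point as\<close> and periodicity, the first mask factor
  depends only on the first letter. The sum over the remaining letters is 1 by induction, and the
  sum over the first letter is \<open>sum_digit_mask_shift\<close>.\<close>

lemma sum_mask_prod: "(\<Sum>as\<in>digit_words n. (cmod (mask_prod n (word_point as + \<eta>)))\<^sup>2) = 1"
proof (induction n arbitrary: \<eta>)
  case 0
  have "digit_words 0 = {[]}" by (auto simp: digit_words_def)
  then show ?case by simp
next
  case (Suc n)
  let ?\<eta> = "contract 1 \<eta>"
  have eq: "mask_prod (Suc n) (word_point (a # as) + \<eta>)
      = digit_mask (?\<eta> + of_int a *\<^sub>R third_shift) * mask_prod n (word_point as + (?\<eta> + of_int a *\<^sub>R third_shift))" for a as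
  proof -
    have "contract 1 (word_point (a # as) + \<eta>) = word_point as + (?\<eta> + of_int a *\<^sub>R third_shift)"
      by (simp add: contract_add del: One_nat_def)
    then show ?thesis by (simp add: digit_mask_periodic word_point_Ints del: word_point.simps)
  qed
  have "(\<Sum>as\<in>digit_words (Suc n). (cmod (mask_prod (Suc n) (word_point as + \<eta>)))\<^sup>2)
      = (\<Sum>(a, as)\<in>{-1,0,1} \<times> digit_words n. (cmod (mask_prod (Suc n) (word_point (a # as) + \<eta>)))\<^sup>2)"
    unfolding digit_words_Suc
    by (subst sum.reindex) (auto simp: inj_on_def case_prod_unfold simp del: mask_prod.simps word_point.simps)
  also have "\<dots> = (\<Sum>a\<in>{-1,0,1}. \<Sum>as\<in>digit_words n. (cmod (mask_prod (Suc n) (word_point (a # as) + \<eta>)))\<^sup>2)"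
    by (rule sum.cartesian_product[symmetric])
  also have "\<dots> = (\<Sum>a\<in>{-1,0,1}. (cmod (digit_mask (?\<eta> + of_int a *\<^sub>R third_shift)))\<^sup>2)"
    unfolding eq norm_mult power_mult_distrib sum_distrib_left[symmetric] Suc.IH by simp
  also have "\<dots> = 1" by (rule sum_digit_mask_shift)
  finally show ?case .
qed

lemma contract_word_point:
  assumes "as \<in> digit_words n"
  shows "\<bar>contract n (word_point as) $ i\<bar> \<le> 1"
proof -
  \<comment> \<open>The sharper bound is the partial sum of the series
    \<open>1/3 + 1/9 + ...\<close>, a form that the induction can carry.\<close>
  have "\<bar>contract n (word_point as) $ i\<bar> \<le> 1/2 - 1/2 * (1/3)^n"
    using assms
  proof (induction n arbitrary: as)
    case (Suc n)
    then obtain a as' where as: "as = a # as'" "a \<in> {-1,0,1}" "as' \<in> digit_words n"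
      unfolding digit_words_Suc by auto
    have "contract (Suc n) (word_point as) = contract n (contract 1 (word_point as))"
      by (simp add: contract_contract)
    also have "\<dots> = contract n (word_point as') + contract n (of_int a *\<^sub>R third_shift)"
      by (simp add: as contract_add del: One_nat_def)
    finally have "\<bar>contract (Suc n) (word_point as) $ i\<bar>
        \<le> \<bar>contract n (word_point as') $ i\<bar> + \<bar>contract n (of_int a *\<^sub>R third_shift) $ i\<bar>"
      by (simp only: vector_add_component abs_triangle_ineq)
    moreover have "\<bar>contract n (of_int a *\<^sub>R third_shift) $ i\<bar> \<le> 1/3 * (1/3)^n"
    proof -
      have "\<bar>(of_int a *\<^sub>R third_shift) $ i\<bar> \<le> 1/3"
        using as(2) exhaust_2[of i] by (auto simp: third_shift_def)
      moreover have "3 ^ n \<le> (3 * real_of_int (q i)) ^ n"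
        using q_ge_1[of i] by (intro power_mono) auto
      moreover have "0 < (3 * real_of_int (q i)) ^ n" using q_pos[of i] by simp
      ultimately have "\<bar>(of_int a *\<^sub>R third_shift) $ i\<bar> / (3 * real_of_int (q i)) ^ n \<le> (1/3) / 3 ^ n"
        by (intro frac_le) auto
      then show ?thesis
        using q_pos[of i] by (simp add: abs_divide power_divide)
    qed
    ultimately show ?case using Suc.IH[OF as(3)] by simp
  qed (simp add: digit_words_def)
  moreover have "(0::real) \<le> (1/3)^n" by simp
  ultimately show ?thesis by linarith
qed

text \<open>If \<open>y\<close> is contracted to a point with a coordinate above
  \<open>R \<ge> 1\<close> in modulus, then that coordinate of \<open>y\<close> exceeds
  \<open>3 * R - 1 \<ge> 2 * R\<close>. Hence the mass outside the unit box is at most the mass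
  outside every box of size \<open>2 ^ n\<close>, which tends to 0.\<close>

lemma AE_component_bound: "AE x in \<mu>. \<forall>i. \<bar>x$i\<bar> \<le> 1"
proof -
  define E where "E R = {x::real^2. \<exists>i. R < \<bar>x$i\<bar>}" for R :: real
  have "open (E R)" for R
    unfolding E_def by (intro open_Collect_ex open_Collect_less continuous_intros)
  then have E[measurable]: "E R \<in> sets borel" for R by simp
  have step: "measure \<mu> (E R) \<le> measure \<mu> (E (2 * R))" if R: "1 \<le> R" for R
  proof -
    have sub: "(\<lambda>y. contract 1 (y + d)) -` E R \<subseteq> E (2 * R)" if d: "d \<in> Sdigits" for d
    proof
      fix y assume "y \<in> (\<lambda>y. contract 1 (y + d)) -` E R"
      then obtain i where i: "R < \<bar>(y + d)$i / (3 * real_of_int (q i))\<bar>" by (auto simp: E_def)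
      have d1: "\<bar>d$i\<bar> \<le> 1" using d exhaust_2[of i] by (auto simp: Sdigits_def)
      have "R * 3 \<le> R * (3 * real_of_int (q i))"
        using R q_ge_1[of i] by (intro mult_left_mono) auto
      also have "\<dots> < \<bar>(y + d)$i\<bar>"
        using i q_pos[of i] by (simp add: abs_divide pos_less_divide_eq)
      finally have "2 * R < \<bar>y$i\<bar>" using d1 R by simp
      then show "y \<in> E (2 * R)" by (auto simp: E_def)
    qed
    have "measure \<mu> (E R) = (1/3) * (\<Sum>d\<in>Sdigits. measure \<mu> ((\<lambda>y. contract 1 (y + d)) -` E R))"
      using measure_self_affine[OF E] unfolding image_Amat .
    also have "\<dots> \<le> (1/3) * (\<Sum>d\<in>Sdigits. measure \<mu> (E (2 * R)))"
      using sub by (intro mult_left_mono sum_mono finite_measure_mono) (auto simp: sets_mu)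
    also have "\<dots> = measure \<mu> (E (2 * R))" by (simp add: card_Sdigits)
    finally show ?thesis .
  qed
  have le: "measure \<mu> (E 1) \<le> measure \<mu> (E (2 ^ n))" for n
  proof (induction n)
    case (Suc n)
    then show ?case using step[of "2 ^ n"] by simp
  qed simp
  have "(\<lambda>n. measure \<mu> (E (2 ^ n))) \<longlonglongrightarrow> measure \<mu> (\<Inter>n. E (2 ^ n))"
  proof (rule finite_Lim_measure_decseq)
    show "decseq (\<lambda>n. E (2 ^ n))"
    proof (rule decseq_SucI, rule subsetI)
      fix n x assume "x \<in> E (2 ^ Suc n)"
      then obtain i where "2 ^ Suc n < \<bar>x$i\<bar>" by (auto simp: E_def)
      moreover have "(2::real) ^ n \<le> 2 ^ Suc n" by simp
      ultimately have "2 ^ n < \<bar>x$i\<bar>" by linarith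
      then show "x \<in> E (2 ^ n)" by (auto simp: E_def)
    qed
  qed (auto simp: sets_mu)
  moreover have "(\<Inter>n. E (2 ^ n)) = {}"
  proof -
    have "\<exists>n. x \<notin> E (2 ^ n)" for x
    proof -
      obtain n where "\<bar>x$1\<bar> + \<bar>x$2\<bar> < 2 ^ n" using real_arch_pow[of 2] by auto
      then show ?thesis unfolding E_def by (intro exI[of _ n]) (auto simp: not_less forall_2)
    qed
    then show ?thesis by blast
  qed
  ultimately have "(\<lambda>n. measure \<mu> (E (2 ^ n))) \<longlonglongrightarrow> 0" by simp
  then have "measure \<mu> (E 1) \<le> 0"
    using le by (intro LIMSEQ_le_const) auto
  then have "emeasure \<mu> (E 1) = 0"
    by (simp add: emeasure_eq_measure measure_le_0_iff)
  then show ?thesis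
    by (intro AE_I[of _ _ "E 1"]) (auto simp: E_def not_le sets_mu E[unfolded E_def])
qed

end

section \<open>Perturbed Bessel inequality\<close>

definition exp_trunc :: "nat \<Rightarrow> complex \<Rightarrow> complex" where
  "exp_trunc N z = (\<Sum>k<N. z ^ k / fact k)"

lemma exp_trunc_tendsto: "(\<lambda>N. exp_trunc N z) \<longlonglongrightarrow> exp z"
  using exp_converges[of z] unfolding exp_trunc_def sums_def
  by (simp add: scaleR_conv_of_real divide_inverse mult.commute)

lemma sum_power_fact_le_exp: "(\<Sum>k<N. r ^ k / fact k) \<le> exp r" if "0 \<le> r" for r :: real
proof -
  have "(\<Sum>k<N. r ^ k /\<^sub>R fact k) \<le> (\<Sum>k. r ^ k /\<^sub>R fact k)"
    using that by (intro sum_le_suminf summable_exp_generic) auto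
  then show ?thesis by (simp add: exp_def divide_inverse mult.commute)
qed

lemma norm_exp_trunc: "cmod (exp_trunc N z) \<le> exp (cmod z)"
proof -
  have "cmod (exp_trunc N z) \<le> (\<Sum>k<N. cmod (z ^ k / fact k))"
    unfolding exp_trunc_def by (rule norm_sum)
  also have "\<dots> = (\<Sum>k<N. cmod z ^ k / fact k)"
    by (simp add: norm_divide norm_power)
  finally show ?thesis using sum_power_fact_le_exp[of "cmod z" N] by simp
qed

text \<open>Split each weight as \<open>sqrt (w i) * sqrt (w i)\<close>. Weights that merely
  dominate \<open>z\<close> allow one choice of \<open>w\<close> to serve many coefficient
  vectors.\<close>

lemma weighted_Cauchy_Schwarz:
  fixes z y :: "'i \<Rightarrow> complex" and w :: "'i \<Rightarrow> real"
  assumes "\<And>i. i \<in> A \<Longrightarrow> cmod (z i) \<le> w i"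
  shows "(cmod (\<Sum>i\<in>A. z i * y i))\<^sup>2 \<le> (\<Sum>i\<in>A. w i) * (\<Sum>i\<in>A. w i * (cmod (y i))\<^sup>2)"
proof -
  have w: "0 \<le> w i" if "i \<in> A" for i using assms[OF that] norm_ge_zero order_trans by blast
  have "cmod (\<Sum>i\<in>A. z i * y i) \<le> (\<Sum>i\<in>A. cmod (z i * y i))" by (rule norm_sum)
  also have "\<dots> \<le> (\<Sum>i\<in>A. sqrt (w i) * (sqrt (w i) * cmod (y i)))"
    using assms w by (intro sum_mono) (simp add: norm_mult mult_right_mono flip: mult.assoc)
  finally have "(cmod (\<Sum>i\<in>A. z i * y i))\<^sup>2 \<le> (\<Sum>i\<in>A. sqrt (w i) * (sqrt (w i) * cmod (y i)))\<^sup>2"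
    by (intro power_mono) auto
  also have "\<dots> \<le> (\<Sum>i\<in>A. (sqrt (w i))\<^sup>2) * (\<Sum>i\<in>A. (sqrt (w i) * cmod (y i))\<^sup>2)"
    by (rule Cauchy_Schwarz_ineq_sum)
  also have "\<dots> = (\<Sum>i\<in>A. w i) * (\<Sum>i\<in>A. w i * (cmod (y i))\<^sup>2)"
    using w by (simp add: power_mult_distrib)
  finally show ?thesis .
qed

text \<open>Group the sum by the value of \<open>\<pi>\<close>: each index of the family is then
  counted at most \<open>m\<close> times.\<close>

lemma (in orthonormal_family) bessel_multiplicity:
  assumes F: "finite F" "\<pi> ` F \<subseteq> I" and mult: "\<And>i. card {l \<in> F. \<pi> l = i} \<le> m"
    and f: "square_integrable M f"
  shows "(\<Sum>l\<in>F. (cmod (L2inner M f (e (\<pi> l))))\<^sup>2) \<le> m * sqnorm M f"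
proof -
  have "(\<Sum>l\<in>F. (cmod (L2inner M f (e (\<pi> l))))\<^sup>2)
      = (\<Sum>i\<in>\<pi> ` F. \<Sum>l\<in>{l\<in>F. \<pi> l = i}. (cmod (L2inner M f (e (\<pi> l))))\<^sup>2)"
    using F by (intro sum.image_gen)
  also have "\<dots> = (\<Sum>i\<in>\<pi> ` F. card {l\<in>F. \<pi> l = i} * (cmod (L2inner M f (e i)))\<^sup>2)"
    by (intro sum.cong) auto
  also have "\<dots> \<le> (\<Sum>i\<in>\<pi> ` F. m * (cmod (L2inner M f (e i)))\<^sup>2)"
    using mult by (intro sum_mono mult_right_mono) auto
  also have "\<dots> = m * (\<Sum>i\<in>\<pi> ` F. (cmod (L2inner M f (e i)))\<^sup>2)"
    by (simp add: sum_distrib_left)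
  also have "\<dots> \<le> m * sqnorm M f"
    using F f by (intro mult_left_mono bessel) auto
  finally show ?thesis .
qed

section \<open>Energy of exponentials along orthogonal sets and spectra\<close>

context sierpinski
begin

lemma ft_0: "ft 0 = 1"
proof -
  have "expo 0 = (\<lambda>_. 1)" by auto
  then show ?thesis unfolding ft_def using prob_space by simp
qed

lemma cmod_ft_minus: "cmod (ft (- \<xi>)) = cmod (ft \<xi>)"
proof -
  have "ft (- \<xi>) = cnj (ft \<xi>)"
    unfolding ft_def Bochner_Integration.integral_cnj[symmetric] cnj_expo ..
  then show ?thesis by simp
qed

lemma square_integrable_bounded:
  assumes [measurable]: "f \<in> borel_measurable borel" and bd: "AE x in \<mu>. cmod (f x) \<le> K"
  shows "square_integrable \<mu> f"
  unfolding square_integrable_def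
proof
  show "integrable \<mu> (\<lambda>x. (cmod (f x))\<^sup>2)"
    using bd by (intro integrable_const_bound[of _ "K\<^sup>2"]) (auto elim!: eventually_mono intro!: power_mono)
qed simp

lemma square_integrable_expo: "square_integrable \<mu> (expo \<xi>)"
  by (rule square_integrable_bounded[where K=1]) auto

lemma orthonormal_family_expo:
  assumes "orthogonal_set \<mu> \<Lambda>"
  shows "orthonormal_family \<mu> \<Lambda> expo"
  using assms by unfold_locales
    (auto simp: square_integrable_expo orthogonal_set_def L2inner_expo ft_0)

text \<open>The terms are the squared Fourier coefficients of \<open>expo (- \<xi>)\<close>, which
  has norm 1. Any constant below 1 could replace \<open>1/2\<close>; staying below 1 makes a finite
  part of the spectrum sufficient.\<close>

lemma spectrum_energy:
  assumes "spectrum_of \<mu> \<Lambda>"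
  obtains F where "finite F" "F \<subseteq> \<Lambda>" "1/2 < (\<Sum>l\<in>F. (cmod (ft (\<xi> + l)))\<^sup>2)"
proof -
  have fam: "orthonormal_family \<mu> \<Lambda> expo"
    using assms by (intro orthonormal_family_expo) (simp add: spectrum_of_def)
  have s: "1/2 < sqnorm \<mu> (expo (- \<xi>))" using prob_space by simp
  have c: "AE x in \<mu>. f x = 0" if "square_integrable \<mu> f" "\<And>l. l \<in> \<Lambda> \<Longrightarrow> L2inner \<mu> f (expo l) = 0" for f
    using assms that by (auto simp: spectrum_of_def)
  obtain F where F: "finite F" "F \<subseteq> \<Lambda>" "1/2 < (\<Sum>l\<in>F. (cmod (L2inner \<mu> (expo (- \<xi>)) (expo l)))\<^sup>2)"
    by (rule parseval_approximation[OF fam _ c square_integrable_expo s]) auto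
  have "cmod (L2inner \<mu> (expo (- \<xi>)) (expo l)) = cmod (ft (\<xi> + l))" for l
    using cmod_ft_minus[of "\<xi> + l"] by (simp add: L2inner_expo)
  then show thesis using that F by simp
qed

text \<open>Enlarging the index set only increases the energy, so the union of the finite sets for
  the individual frequencies serves them all.\<close>

lemma spectrum_energy_uniform:
  assumes "spectrum_of \<mu> \<Lambda>" "finite X"
  obtains F where "finite F" "F \<subseteq> \<Lambda>" "\<And>\<xi>. \<xi> \<in> X \<Longrightarrow> 1/2 < (\<Sum>l\<in>F. (cmod (ft (\<xi> + l)))\<^sup>2)"
proof -
  have "\<exists>F. finite F \<and> F \<subseteq> \<Lambda> \<and> 1/2 < (\<Sum>l\<in>F. (cmod (ft (\<xi> + l)))\<^sup>2)" for \<xi>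
    by (rule spectrum_energy[OF assms(1), of \<xi>]) blast
  then obtain G where G: "\<And>\<xi>. finite (G \<xi>)" "\<And>\<xi>. G \<xi> \<subseteq> \<Lambda>" "\<And>\<xi>. 1/2 < (\<Sum>l\<in>G \<xi>. (cmod (ft (\<xi> + l)))\<^sup>2)"
    using spectrum_energy[OF assms(1)] by metis
  show thesis
  proof (rule that[of "\<Union> (G ` X)"])
    fix \<xi> assume "\<xi> \<in> X"
    then have "(\<Sum>l\<in>G \<xi>. (cmod (ft (\<xi> + l)))\<^sup>2) \<le> (\<Sum>l\<in>\<Union> (G ` X). (cmod (ft (\<xi> + l)))\<^sup>2)"
      using G assms(2) by (intro sum_mono2) auto
    then show "1/2 < (\<Sum>l\<in>\<Union> (G ` X). (cmod (ft (\<xi> + l)))\<^sup>2)"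
      using G(3)[of \<xi>] by linarith
  qed (use G assms(2) in auto)
qed

text \<open>Expanding \<open>expo (- t)\<close> into monomials and applying Bessel's inequality to each monomial
  bounds the perturbed energy by that of the orthogonal set itself.\<close>
lemma plancherel_polya:
  assumes orth: "orthogonal_set \<mu> \<Lambda>"
    and F: "finite F" "\<pi> ` F \<subseteq> \<Lambda>" and mult: "\<And>i. card {l \<in> F. \<pi> l = i} \<le> m"
    and t: "\<And>l i. l \<in> F \<Longrightarrow> \<bar>t l $ i\<bar> \<le> T" and T: "0 \<le> T"
  shows "(\<Sum>l\<in>F. (cmod (ft (\<pi> l + t l)))\<^sup>2) \<le> m * exp (2 * pi * T) ^ 4"
proof -
  interpret orthonormal_family \<mu> \<Lambda> expo by (rule orthonormal_family_expo[OF orth])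
  define r where "r = 2 * pi * T"
  have r: "0 \<le> r" using T by (simp add: r_def)
  define Z where "Z l i = 2 * pi * \<i> * complex_of_real (t l $ i)" for l i
  have Z: "cmod (Z l i) \<le> r" if "l \<in> F" for l i
    using t[OF that, of i] by (simp add: Z_def norm_mult r_def)
  \<comment> \<open>\<open>expo (- t l) x\<close> is the product of \<open>exp (Z l i * x$i)\<close>
    over the two coordinates; \<open>g N l\<close> truncates both Taylor series and is a polynomial
    in \<open>x\<close>.\<close>
  define g where "g N l x = exp_trunc N (Z l 1 * of_real (x$1)) * exp_trunc N (Z l 2 * of_real (x$2))"
    for N l and x :: "real^2"
  define mon where "mon p x = complex_of_real ((x$1) ^ fst p * (x$2) ^ snd p)" for p :: "nat \<times> nat" and x :: "real^2"
  define co where "co l p = Z l 1 ^ fst p / fact (fst p) * (Z l 2 ^ snd p / fact (snd p))" for l and p :: "nat \<times> nat"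
  \<comment> \<open>This majorant of \<open>co l p\<close> does not depend on \<open>l\<close>, so
    after Cauchy-Schwarz the sums over \<open>l\<close> and \<open>p\<close> can be
    interchanged.\<close>
  define w where "w p = r ^ fst p / fact (fst p) * (r ^ snd p / fact (snd p))" for p :: "nat \<times> nat"
  have g_eq: "g N l = (\<lambda>x. \<Sum>p\<in>{..<N} \<times> {..<N}. co l p * mon p x)" for N l
  proof
    fix x
    show "g N l x = (\<Sum>p\<in>{..<N} \<times> {..<N}. co l p * mon p x)"
      unfolding g_def exp_trunc_def sum_product sum.cartesian_product
      by (intro sum.cong) (auto simp: co_def mon_def power_mult_distrib)
  qed
  have [measurable]: "mon p \<in> borel_measurable borel" for p
    unfolding mon_def by (intro borel_measurable_continuous_onI continuous_intros)
  have mon_bd: "AE x in \<mu>. cmod (mon p x) \<le> 1" for p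
    using AE_component_bound
  proof eventually_elim
    case (elim x)
    then have "\<bar>x$1\<bar> ^ fst p * \<bar>x$2\<bar> ^ snd p \<le> 1 * 1"
      by (intro mult_mono power_le_one) auto
    then show ?case by (simp add: mon_def norm_mult norm_power)
  qed
  have mon_sq: "square_integrable \<mu> (mon p)" for p
    by (rule square_integrable_bounded[OF _ mon_bd]) measurable
  have mon_norm: "sqnorm \<mu> (mon p) \<le> 1" for p
  proof -
    have "sqnorm \<mu> (mon p) \<le> (LINT x|\<mu>. 1)"
      using mon_sq[of p] mon_bd[of p]
      by (intro integral_mono_AE) (auto simp: square_integrable_def power_le_one elim!: eventually_mono)
    then show ?thesis using prob_space by simp
  qed
  have w_sum: "(\<Sum>p\<in>{..<N} \<times> {..<N}. w p) \<le> exp r ^ 2" for N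
  proof -
    have "(\<Sum>p\<in>{..<N} \<times> {..<N}. w p) = (\<Sum>k<N. r ^ k / fact k) * (\<Sum>k<N. r ^ k / fact k)"
      unfolding sum_product sum.cartesian_product w_def by (intro sum.cong) auto
    also have "\<dots> \<le> exp r * exp r"
      using r by (intro mult_mono sum_power_fact_le_exp sum_nonneg) auto
    finally show ?thesis by (simp add: power2_eq_square)
  qed
  have w_nonneg: "0 \<le> w p" for p using r by (simp add: w_def)
  have co_le: "cmod (co l p) \<le> w p" if "l \<in> F" for l p
    unfolding co_def w_def norm_mult norm_divide norm_power
    using Z[OF that] r by (auto intro!: mult_mono divide_right_mono power_mono)
  have trunc: "(\<Sum>l\<in>F. (cmod (L2inner \<mu> (g N l) (expo (\<pi> l))))\<^sup>2) \<le> m * exp r ^ 4" for N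
  proof -
    let ?A = "{..<N} \<times> {..<N}"
    let ?c = "\<lambda>l p. (cmod (L2inner \<mu> (mon p) (expo (\<pi> l))))\<^sup>2"
    have "(cmod (L2inner \<mu> (g N l) (expo (\<pi> l))))\<^sup>2 \<le> (\<Sum>p\<in>?A. w p) * (\<Sum>p\<in>?A. w p * ?c l p)"
      if "l \<in> F" for l
    proof -
      have "L2inner \<mu> (g N l) (expo (\<pi> l)) = (\<Sum>p\<in>?A. co l p * L2inner \<mu> (mon p) (expo (\<pi> l)))"
        unfolding g_eq by (intro L2inner_sum_left mon_sq square_integrable_expo)
      then show ?thesis
        using weighted_Cauchy_Schwarz[of ?A "co l" w] co_le[OF that] by simp
    qed
    then have "(\<Sum>l\<in>F. (cmod (L2inner \<mu> (g N l) (expo (\<pi> l))))\<^sup>2)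
        \<le> (\<Sum>l\<in>F. (\<Sum>p\<in>?A. w p) * (\<Sum>p\<in>?A. w p * ?c l p))"
      by (rule sum_mono)
    also have "\<dots> = (\<Sum>p\<in>?A. w p) * (\<Sum>p\<in>?A. w p * (\<Sum>l\<in>F. ?c l p))"
      unfolding sum_distrib_left[symmetric] by (subst sum.swap) (simp add: sum_distrib_left)
    also have "\<dots> \<le> (\<Sum>p\<in>?A. w p) * (\<Sum>p\<in>?A. w p * m)"
    proof (intro mult_left_mono sum_mono)
      fix p
      have "(\<Sum>l\<in>F. ?c l p) \<le> m * sqnorm \<mu> (mon p)"
        by (rule bessel_multiplicity[OF F mult mon_sq])
      also have "\<dots> \<le> real m * 1" by (intro mult_left_mono mon_norm) auto
      finally show "(\<Sum>l\<in>F. ?c l p) \<le> m" by simp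
    qed (auto intro: w_nonneg sum_nonneg)
    also have "\<dots> = m * (\<Sum>p\<in>?A. w p) ^ 2"
      by (simp add: power2_eq_square sum_distrib_right[symmetric])
    \<comment> \<open>The fourth power arises here: the total weight contributes one
      \<open>exp r\<close> per coordinate and occurs twice, once from Cauchy-Schwarz and once from
      summing the Bessel bounds.\<close>
    also have "\<dots> \<le> m * (exp r ^ 2) ^ 2"
      using w_sum w_nonneg by (intro mult_left_mono power_mono sum_nonneg) auto
    finally show ?thesis by (simp flip: power_mult)
  qed
  \<comment> \<open>The bound for \<open>g N l\<close> is uniform in \<open>N\<close>. The constant
    majorant for dominated convergence is available because almost all \<open>x\<close> have
    coordinates bounded by 1.\<close>
  have lim: "(\<lambda>N. L2inner \<mu> (g N l) (expo (\<pi> l))) \<longlonglongrightarrow> L2inner \<mu> (expo (- t l)) (expo (\<pi> l))" if l: "l \<in> F" for l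
    unfolding L2inner_def
  proof (rule integral_dominated_convergence[where w="\<lambda>_. exp r * exp r"])
    show "(\<lambda>x. g N l x * cnj (expo (\<pi> l) x)) \<in> borel_measurable \<mu>" for N
      unfolding g_eq cnj_expo by measurable
    show "AE x in \<mu>. (\<lambda>N. g N l x * cnj (expo (\<pi> l) x)) \<longlonglongrightarrow> expo (- t l) x * cnj (expo (\<pi> l) x)"
    proof (intro AE_I2 tendsto_intros)
      fix x
      have "expo (- t l) x = exp (Z l 1 * of_real (x$1)) * exp (Z l 2 * of_real (x$2))"
        by (simp add: expo_def Z_def inner_vec_def sum_2 algebra_simps flip: exp_add)
      then show "(\<lambda>N. g N l x) \<longlonglongrightarrow> expo (- t l) x"
        unfolding g_def by (simp only:) (intro tendsto_intros exp_trunc_tendsto)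
    qed
    show "AE x in \<mu>. cmod (g N l x * cnj (expo (\<pi> l) x)) \<le> exp r * exp r" for N
      using AE_component_bound
    proof eventually_elim
      case (elim x)
      have "cmod (exp_trunc N (Z l i * of_real (x$i))) \<le> exp r" for i
      proof -
        have "cmod (Z l i * of_real (x$i)) \<le> r * 1"
          unfolding norm_mult using Z[OF l, of i] elim r by (intro mult_mono) auto
        then show ?thesis using norm_exp_trunc[of N "Z l i * of_real (x$i)"] by (simp add: order_trans)
      qed
      then have "cmod (g N l x) \<le> exp r * exp r"
        unfolding g_def norm_mult by (intro mult_mono) auto
      then show ?case by (simp add: norm_mult)
    qed
  qed (auto simp: cnj_expo)
  have "(\<lambda>N. \<Sum>l\<in>F. (cmod (L2inner \<mu> (g N l) (expo (\<pi> l))))\<^sup>2)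
      \<longlonglongrightarrow> (\<Sum>l\<in>F. (cmod (L2inner \<mu> (expo (- t l)) (expo (\<pi> l))))\<^sup>2)"
    by (intro tendsto_intros lim)
  then have "(\<Sum>l\<in>F. (cmod (L2inner \<mu> (expo (- t l)) (expo (\<pi> l))))\<^sup>2) \<le> m * exp r ^ 4"
    using trunc by (intro LIMSEQ_le_const2) auto
  moreover have "cmod (L2inner \<mu> (expo (- t l)) (expo (\<pi> l))) = cmod (ft (\<pi> l + t l))" for l
  proof -
    have "- t l - \<pi> l = - (\<pi> l + t l)" by simp
    then show ?thesis unfolding L2inner_expo by (simp only: cmod_ft_minus)
  qed
  ultimately show ?thesis by (simp add: r_def)
qed

section \<open>Many points of a spectrum in one ball\<close>

lemma norm_expand: "norm (expand n v) \<le> (3 * real_of_int (q 2)) ^ n * norm v"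
proof -
  have "norm (expand n v) \<le> norm ((3 * real_of_int (q 2)) ^ n *\<^sub>R v)"
  proof (rule norm_le_componentwise_cart)
    fix i
    have "real_of_int (q i) \<le> real_of_int (q 2)" using q_le exhaust_2[of i] by auto
    then have "(3 * real_of_int (q i)) ^ n \<le> (3 * real_of_int (q 2)) ^ n"
      using q_pos[of i] by (intro power_mono) auto
    then show "norm (expand n v $ i) \<le> norm (((3 * real_of_int (q 2)) ^ n *\<^sub>R v) $ i)"
      using q_pos[of i] q_pos[of 2] by (simp add: abs_mult mult_right_mono del: power_mult_distrib)
  qed
  also have "\<dots> = (3 * real_of_int (q 2)) ^ n * norm v"
    using q_pos[of 2] by simp
  finally show ?thesis .
qed

lemma norm_contract:
  assumes "1 \<le> n"
  shows "norm (contract n v) \<le> norm v / 3"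
proof -
  have "norm (contract n v) \<le> norm ((1/3) *\<^sub>R v)"
  proof (rule norm_le_componentwise_cart)
    fix i
    have "3 \<le> 3 * real_of_int (q i)" using q_ge_1[of i] by simp
    also have "\<dots> \<le> (3 * real_of_int (q i)) ^ n"
      using q_ge_1[of i] assms by (intro self_le_power) auto
    finally have "\<bar>v$i\<bar> / (3 * real_of_int (q i)) ^ n \<le> \<bar>v$i\<bar> / 3"
      by (intro divide_left_mono) auto
    moreover have "\<bar>(3 * real_of_int (q i)) ^ n\<bar> = (3 * real_of_int (q i)) ^ n"
      using q_pos[of i] by simp
    ultimately show "norm (contract n v $ i) \<le> norm (((1/3) *\<^sub>R v) $ i)"
      by (simp add: abs_divide del: power_mult_distrib)
  qed
  then show ?thesis by simp
qed

text \<open>After summing the energy over all words, one term remains for each \<open>l\<close>,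
  with argument coordinatewise within \<open>C + 1\<close> of \<open>\<pi> l\<close>:
  \<open>C\<close> comes from \<open>near\<close> and 1 from \<open>contract_word_point\<close>.
  \<open>plancherel_polya\<close> then forces a large fibre of \<open>\<pi>\<close>, and a fibre
  fits into one ball.\<close>

lemma many_points_in_ball:
  assumes spec: "spectrum_of \<mu> \<Lambda>" and C: "0 \<le> C"
    and near: "\<And>l. l \<in> \<Lambda> \<Longrightarrow> \<exists>g\<in>\<Lambda>. norm (contract n l - g) \<le> C"
  obtains x where "3 ^ n / 2 \<le> card (\<Lambda> \<inter> ball x ((C + 1) * (3 * real_of_int (q 2)) ^ n)) * exp (2 * pi * (C + 1)) ^ 4"
proof -
  have orth: "orthogonal_set \<mu> \<Lambda>" using spec by (simp add: spectrum_of_def)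
  let ?h = "(C + 1) * (3 * real_of_int (q 2)) ^ n"
  let ?E = "exp (2 * pi * (C + 1)) ^ 4"
  \<comment> \<open>An infinite set has \<open>card\<close> 0, so finiteness must precede the
    comparison of cardinalities.\<close>
  have fin: "finite (\<Lambda> \<inter> ball x ?h)" for x
  proof -
    obtain k where "2 * ?h < (3 * real_of_int (q 2)) ^ k"
      using real_arch_pow[of "3 * real_of_int (q 2)"] q_ge_1[of 2] by fastforce
    then show ?thesis using card_orthogonal_ball(1)[OF orth, of ?h k x] by simp
  qed
  obtain \<pi> where \<pi>: "\<And>l. l \<in> \<Lambda> \<Longrightarrow> \<pi> l \<in> \<Lambda>" "\<And>l. l \<in> \<Lambda> \<Longrightarrow> norm (contract n l - \<pi> l) \<le> C"
    using near by metis
  obtain F where F: "finite F" "F \<subseteq> \<Lambda>"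
    and energy: "\<And>as. as \<in> digit_words n \<Longrightarrow> 1/2 < (\<Sum>l\<in>F. (cmod (ft (word_point as + l)))\<^sup>2)"
    using spectrum_energy_uniform[OF spec, of "word_point ` digit_words n"] finite_digit_words by (metis finite_imageI imageI)
  have words: "digit_words n \<noteq> {}"
    using card_digit_words[of n] by auto
  let ?a = "\<lambda>l as. (cmod (ft (contract n (word_point as + l))))\<^sup>2"
  have "\<exists>as\<in>digit_words n. \<forall>bs\<in>digit_words n. ?a l bs \<le> ?a l as" for l
  proof -
    have "Max (?a l ` digit_words n) \<in> ?a l ` digit_words n"
      using finite_digit_words words by (intro Max_in) auto
    then obtain as where "as \<in> digit_words n" "?a l as = Max (?a l ` digit_words n)" by auto
    then show ?thesis using finite_digit_words by (intro bexI[of _ as]) auto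
  qed
  \<comment> \<open>\<open>b l\<close> is the word with the largest tail factor at \<open>l\<close>.
    Using it for all words takes the tail factor out of the sum over words, where the mask products
    add up to 1.\<close>
  then obtain b where b: "\<And>l. b l \<in> digit_words n" "\<And>l bs. bs \<in> digit_words n \<Longrightarrow> ?a l bs \<le> ?a l (b l)"
    by metis
  have F_ne: "F \<noteq> {}" using energy words by fastforce
  define m where "m = Max ((\<lambda>g. card {l\<in>F. \<pi> l = g}) ` \<pi> ` F)"
  have m: "card {l\<in>F. \<pi> l = g} \<le> m" for g
  proof (cases "g \<in> \<pi> ` F")
    case True
    then show ?thesis unfolding m_def using F by (intro Max_ge) auto
  next
    case False
    then have "{l\<in>F. \<pi> l = g} = {}" by auto
    then show ?thesis by (simp only: card.empty)
  qed
  \<comment> \<open>The maximum is attained, so the multiplicity bound is the size of an actual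
    fibre.\<close>
  have "m \<in> (\<lambda>g. card {l\<in>F. \<pi> l = g}) ` \<pi> ` F"
    unfolding m_def using F F_ne by (intro Max_in) auto
  then obtain g where g: "g \<in> \<pi> ` F" "m = card {l\<in>F. \<pi> l = g}" by blast
  have "3 ^ n / 2 = (\<Sum>as\<in>digit_words n. 1/2 :: real)"
    by (simp add: card_digit_words)
  also have "\<dots> \<le> (\<Sum>as\<in>digit_words n. \<Sum>l\<in>F. (cmod (ft (word_point as + l)))\<^sup>2)"
    using energy by (intro sum_mono less_imp_le)
  also have "\<dots> = (\<Sum>l\<in>F. \<Sum>as\<in>digit_words n. (cmod (ft (word_point as + l)))\<^sup>2)"
    by (rule sum.swap)
  also have "\<dots> \<le> (\<Sum>l\<in>F. \<Sum>as\<in>digit_words n. (cmod (mask_prod n (word_point as + l)))\<^sup>2 * ?a l (b l))"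
  proof (intro sum_mono)
    fix l as assume "as \<in> digit_words n"
    then have "(cmod (mask_prod n (word_point as + l)))\<^sup>2 * ?a l as \<le> (cmod (mask_prod n (word_point as + l)))\<^sup>2 * ?a l (b l)"
      by (intro mult_left_mono b(2)) auto
    then show "(cmod (ft (word_point as + l)))\<^sup>2 \<le> (cmod (mask_prod n (word_point as + l)))\<^sup>2 * ?a l (b l)"
      by (subst ft_eq_mask_prod[of _ n]) (simp add: norm_mult power_mult_distrib)
  qed
  also have "\<dots> = (\<Sum>l\<in>F. ?a l (b l))"
    by (simp add: sum_mask_prod flip: sum_distrib_right)
  also have "\<dots> = (\<Sum>l\<in>F. (cmod (ft (\<pi> l + (contract n (word_point (b l)) + (contract n l - \<pi> l)))))\<^sup>2)"
    by (simp add: contract_add algebra_simps)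
  also have "\<dots> \<le> m * ?E"
  proof (rule plancherel_polya[OF orth F(1) _ m])
    show "\<pi> ` F \<subseteq> \<Lambda>" using \<pi>(1) F(2) by auto
    fix l i assume "l \<in> F"
    then have "\<bar>(contract n l - \<pi> l) $ i\<bar> \<le> C"
      using \<pi>(2)[of l] F(2) component_le_norm_cart[of "contract n l - \<pi> l" i] by auto
    then show "\<bar>(contract n (word_point (b l)) + (contract n l - \<pi> l)) $ i\<bar> \<le> C + 1"
      using contract_word_point[OF b(1), of l i] by (simp only: vector_add_component)
  qed (use C in simp)
  \<comment> \<open>Expanding again turns distance \<open>C\<close> into at most
    \<open>C * (3 * q 2) ^ n\<close>; the \<open>+ 1\<close> in the radius gives the strict
    inequality of an open ball.\<close>
  also have "\<dots> \<le> card (\<Lambda> \<inter> ball (expand n g) ?h) * ?E"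
  proof -
    have "l \<in> ball (expand n (\<pi> l)) ?h" if "l \<in> F" for l
    proof -
      have "expand n (contract n l - \<pi> l) = l - expand n (\<pi> l)"
        by (simp add: vec_eq_iff algebra_simps)
      then have "dist (expand n (\<pi> l)) l \<le> (3 * real_of_int (q 2)) ^ n * norm (contract n l - \<pi> l)"
        using norm_expand[of n "contract n l - \<pi> l"] by (simp add: dist_norm norm_minus_commute)
      also have "\<dots> \<le> (3 * real_of_int (q 2)) ^ n * C"
        using \<pi>(2)[of l] F(2) that q_pos[of 2] by (intro mult_left_mono) auto
      also have "\<dots> < ?h"
        using q_pos[of 2] by (simp add: distrib_right mult.commute)
      finally show ?thesis by simp
    qed
    then have "{l\<in>F. \<pi> l = g} \<subseteq> \<Lambda> \<inter> ball (expand n g) ?h"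
      using F(2) by auto
    then have "m \<le> card (\<Lambda> \<inter> ball (expand n g) ?h)"
      unfolding g(2) by (intro card_mono fin)
    then show ?thesis by (intro mult_right_mono) auto
  qed
  finally show thesis by (rule that)
qed

end

section \<open>The dimension theorem\<close>

context sierpinski
begin

definition dimension :: real where
  "dimension = ln 3 / ln (3 * real_of_int (q 2))"

lemma dimension_pos: "0 < dimension"
  unfolding dimension_def using q_ge_1[of 2] by (intro divide_pos_pos ln_gt_zero) auto

lemma powr_dimension: "(3 * real_of_int (q 2)) powr dimension = 3"
  using q_ge_1[of 2] by (simp add: dimension_def powr_def)

lemma beurling_dim_orthogonal:
  assumes orth: "orthogonal_set \<mu> \<Lambda>"
  shows "beurling_dim \<Lambda> \<le> ereal dimension"
proof (rule beurling_dim_le[OF dimension_pos])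
  show "0 < 3 * 2 powr dimension" by simp
  fix x :: "real^2" and h :: real assume h: "1 \<le> h"
  let ?c = "3 * real_of_int (q 2)"
  have c: "1 < ?c" using q_ge_1[of 2] by simp
  \<comment> \<open>The least \<open>n\<close> with \<open>2 * h \<le> (3 * q 2) ^ n\<close>.
    Rounding up costs at most a factor 3 in the count, and doubling \<open>h\<close> costs
    \<open>2 powr dimension\<close>.\<close>
  define n where "n = nat \<lceil>log ?c (2 * h)\<rceil>"
  have "0 \<le> log ?c (2 * h)" using c h by simp
  then have n: "log ?c (2 * h) \<le> n" "n \<le> log ?c (2 * h) + 1"
    unfolding n_def by linarith+
  have "2 * h = ?c powr log ?c (2 * h)" using c h by simp
  also have "\<dots> \<le> ?c powr n" using c n by (intro powr_mono) auto
  also have "\<dots> = ?c ^ n" using c by (simp add: powr_realpow)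
  finally have "2 * h \<le> ?c ^ n" .
  note card = card_orthogonal_ball[OF orth this, of x]
  have "real (card (\<Lambda> \<inter> ball x h)) \<le> real (3 ^ n)"
    using card(2) by (simp only: of_nat_le_iff)
  also have "real (3 ^ n) = 3 powr n" by (simp add: powr_realpow)
  also have "\<dots> \<le> 3 powr (log ?c (2 * h) + 1)" using n by (intro powr_mono) auto
  also have "\<dots> = 3 * (?c powr dimension) powr log ?c (2 * h)"
    by (simp only: powr_dimension powr_add) simp
  also have "\<dots> = 3 * (?c powr log ?c (2 * h)) powr dimension"
    by (simp only: powr_powr mult.commute)
  also have "\<dots> = 3 * (2 * h) powr dimension" using c h by simp
  also have "\<dots> = 3 * 2 powr dimension * h powr dimension" using h by (simp add: powr_mult)
  finally have "real (card (\<Lambda> \<inter> ball x h)) \<le> 3 * 2 powr dimension * h powr dimension" .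
  then show "ecard (\<Lambda> \<inter> ball x h) \<le> ereal (3 * 2 powr dimension * h powr dimension)"
    using card(1) by (simp add: ecard_def)
qed

text \<open>Errors do not accumulate: each new step shrinks the old error by at least 3 and adds at
  most \<open>K\<close>, and \<open>2 * K / 3 + K \<le> 2 * K\<close>.\<close>

lemma contract_pow_near:
  assumes p: "1 \<le> p" and K: "0 \<le> K"
    and near: "\<And>l. l \<in> \<Lambda> \<Longrightarrow> \<exists>g\<in>\<Lambda>. norm (contract p l - g) \<le> K"
    and l: "l \<in> \<Lambda>"
  shows "\<exists>g\<in>\<Lambda>. norm (contract (p * n) l - g) \<le> 2 * K"
proof (induction n)
  case 0
  then show ?case using l K by (intro bexI[of _ l]) auto
next
  case (Suc n)
  then obtain g where g: "g \<in> \<Lambda>" "norm (contract (p * n) l - g) \<le> 2 * K" by blast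
  obtain g' where g': "g' \<in> \<Lambda>" "norm (contract p g - g') \<le> K" using near[OF g(1)] by blast
  have "contract (p * Suc n) l = contract p ((contract (p * n) l - g) + g)"
    by (simp add: contract_contract)
  then have "contract (p * Suc n) l - g' = contract p (contract (p * n) l - g) + (contract p g - g')"
    unfolding contract_add by simp
  then have "norm (contract (p * Suc n) l - g') \<le> norm (contract p (contract (p * n) l - g)) + norm (contract p g - g')"
    by (simp only: norm_triangle_ineq)
  also have "\<dots> \<le> 2 * K / 3 + K"
    using norm_contract[OF p, of "contract (p * n) l - g"] g(2) g'(2) by linarith
  also have "\<dots> \<le> 2 * K" using K by simp
  finally show ?case using g'(1) by blast
qed

text \<open>Nearness is available only for multiples of \<open>p\<close>, so only the radii of order
  \<open>(3 * q 2) ^ (p * n)\<close> are controlled. This is enough for an upper density.\<close>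

lemma beurling_dim_spectrum:
  assumes spec: "spectrum_of \<mu> \<Lambda>" and p: "1 \<le> p" and K: "0 \<le> K"
    and near: "\<And>l. l \<in> \<Lambda> \<Longrightarrow> \<exists>g\<in>\<Lambda>. norm (contract p l - g) \<le> K"
  shows "ereal dimension \<le> beurling_dim \<Lambda>"
proof -
  let ?c = "3 * real_of_int (q 2)"
  have c: "3 \<le> ?c" using q_ge_1[of 2] by simp
  define h where "h n = (2 * K + 1) * ?c ^ (p * n)" for n
  define E where "E = exp (2 * pi * (2 * K + 1)) ^ 4"
  \<comment> \<open>Chosen so that \<open>d * h n powr dimension\<close> equals
    \<open>3 ^ (p * n) / 2 / E\<close>, the count given by \<open>many_points_in_ball\<close> with
    \<open>C = 2 * K\<close>.\<close>
  define d where "d = 1 / (2 * E * (2 * K + 1) powr dimension)"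
  have E: "0 < E" by (simp add: E_def)
  show ?thesis
  proof (rule beurling_dim_ge)
    show "0 < d" using E K by (simp add: d_def)
    have "filterlim (\<lambda>n. z ^ n) at_top sequentially" if "1 < z" for z :: real
      using that by (intro filterlim_at_infinity_imp_filterlim_at_top
        filterlim_realpow_sequentially_gt1 always_eventually) auto
    moreover have "1 < ?c ^ p" using c p by (intro one_less_power) auto
    ultimately have "filterlim (\<lambda>n. (?c ^ p) ^ n) at_top sequentially" by blast
    then show "filterlim h at_top sequentially"
      unfolding h_def power_mult using K
      by (intro filterlim_tendsto_pos_mult_at_top[OF tendsto_const]) auto
  next
    fix n :: nat
    obtain x where x: "3 ^ (p * n) / 2 \<le> card (\<Lambda> \<inter> ball x (h n)) * E"
      unfolding h_def E_def
      by (rule many_points_in_ball[OF spec _ contract_pow_near[OF p K near]]) (use K in auto)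
    have powr: "(z ^ k) powr a = (z powr a) ^ k" if "0 < z" for z a :: real and k
      using that by (induction k) (simp_all add: powr_mult)
    have "(?c ^ (p * n)) powr dimension = 3 ^ (p * n)"
      using c by (subst powr) (simp_all only: powr_dimension)
    moreover have "h n powr dimension = (2 * K + 1) powr dimension * (?c ^ (p * n)) powr dimension"
      unfolding h_def by (rule powr_mult)
    ultimately have "h n powr dimension = (2 * K + 1) powr dimension * 3 ^ (p * n)"
      by (simp only:)
    then have "d * h n powr dimension = 3 ^ (p * n) / 2 / E"
      using K E by (simp add: d_def)
    also have "\<dots> \<le> card (\<Lambda> \<inter> ball x (h n))"
      using x E by (simp add: pos_divide_le_eq)
    finally have "ereal (d * h n powr dimension) \<le> ecard (\<Lambda> \<inter> ball x (h n))"
      by (simp add: ecard_def)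
    then show "\<exists>x. ereal (d * h n powr dimension) \<le> ecard (\<Lambda> \<inter> ball x (h n))" by blast
  qed
qed

end

theorem theorem1p3:
  fixes q1 q2 :: int and \<mu> :: "(real^2) measure" and \<Lambda> :: "(real^2) set"
  assumes "1 \<le> q1" and "q1 \<le> q2"
    and "self_affine_measure (Amat q1 q2) Sdigits \<mu>"
    and "orthogonal_set \<mu> \<Lambda>"
  shows "beurling_dim \<Lambda> \<le> ereal (ln 3 / ln (3 * real_of_int q2)) \<and>
         ((spectrum_of \<mu> \<Lambda> \<and>
           (\<exists>p::nat. p \<ge> 1 \<and>
              bdd_above ((\<lambda>l. infdist (Ainv_pow (Amat q1 q2) p l) \<Lambda>) ` \<Lambda>)))
          \<longrightarrow> beurling_dim \<Lambda> = ereal (ln 3 / ln (3 * real_of_int q2)))"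
proof -
  \<comment> \<open>Indexing the two entries by the type \<open>2\<close> lets one coordinatewise
    argument treat both.\<close>
  define q :: "2 \<Rightarrow> int" where "q i = (if i = 1 then q1 else q2)" for i
  have q: "q 1 = q1" "q 2 = q2" by (simp_all add: q_def)
  interpret sierpinski q \<mu>
    by unfold_locales (use assms in \<open>auto simp: q_def\<close>)
  have dim: "ln 3 / ln (3 * real_of_int q2) = dimension"
    by (simp add: dimension_def q)
  have upper: "beurling_dim \<Lambda> \<le> ereal dimension"
    by (rule beurling_dim_orthogonal[OF assms(4)])
  moreover have "ereal dimension \<le> beurling_dim \<Lambda>"
    if spec: "spectrum_of \<mu> \<Lambda>" and p: "1 \<le> p"
      and bdd: "bdd_above ((\<lambda>l. infdist (Ainv_pow (Amat q1 q2) p l) \<Lambda>) ` \<Lambda>)" for p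
  proof -
    obtain K where K: "\<And>l. l \<in> \<Lambda> \<Longrightarrow> infdist (contract p l) \<Lambda> \<le> K"
      using bdd Ainv_pow_eq[of p] by (auto simp: q bdd_above_def)
    \<comment> \<open>The infimum may not be attained, so 1 is added as slack; the absolute value
      keeps the constant nonnegative.\<close>
    have near: "\<exists>g\<in>\<Lambda>. norm (contract p l - g) \<le> \<bar>K\<bar> + 1" if l: "l \<in> \<Lambda>" for l
    proof -
      have "infdist (contract p l) \<Lambda> < \<bar>K\<bar> + 1" using K[OF l] by linarith
      \<comment> \<open>\<open>infdist\<close> to an empty set is 0 by convention; the element
        \<open>l\<close> rules that case out.\<close>
      then have "(INF g\<in>\<Lambda>. dist (contract p l) g) < \<bar>K\<bar> + 1"
        using l by (auto simp: infdist_def split: if_splits)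
      then obtain g where "g \<in> \<Lambda>" "dist (contract p l) g < \<bar>K\<bar> + 1"
        using cINF_less_iff[of \<Lambda> "dist (contract p l)"] l by (auto simp: bdd_below_def intro: zero_le_dist)
      then show ?thesis by (intro bexI[of _ g]) (auto simp: dist_norm)
    qed
    show ?thesis by (rule beurling_dim_spectrum[OF spec p _ near]) auto
  qed
  ultimately show ?thesis unfolding dim by (auto intro: antisym)
qed

end
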